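(* For each $d \in \mathbb{N}$, there exists $c_d > 0$ such that for every $n \geq d+1$, \[ \inf_{\tilde{f}_n \in \tilde{\mathcal{F}}_n} \ \sup_{f \in \mathcal{F}_d} \mathbb{E}_f\bigl\{h^2(\tilde{f}_n,f)\bigr\} \geq \begin{cases} c_1 n^{-4/5} & \text{if } d=1, \\ c_d\, n^{-2/(d+1)} & \text{if } d \geq 2. \end{cases} \]
   Context: $\mu_d$ denotes Lebesgue measure on $\mathbb{R}^d$. $\mathcal{F}_d$ denotes the set of upper semi-continuous, log-concave densities on $\mathbb{R}^d$ with respect to $\mu_d$, i.e. densities of the form $f = e^{\phi}$ with $\phi:\mathbb{R}^d \to [-\infty,\infty)$ upper semi-continuous and concave (so $f$ need not be positive everywhere). For a density $f \in \mathcal{F}_d$, let $X_1,\ldots,X_n$ be independent and identically distributed random vectors with density $f$, and let $\mathbb{E}_f$ denote the corresponding expectation. An estimator $\tilde{f}_n$ is a measurable function from $(\mathbb{R}^d)^{n}$ (the sample space of $(X_1,\ldots,X_n)$) to the class of probability densities with respect to $\mu_d$ (equipped with the $\sigma$-algebra it inherits as a subset of $L_1(\mathbb{R}^d)$); $\tilde{\mathcal{F}}_n$ denotes the class of all such estimators, and in the risk $\tilde f_n$ is evaluated at $(X_1,\ldots,X_n)$. The squared Hellinger distance is $h^2(f,g) := \int_{\mathbb{R}^d} (f^{1/2} - g^{1/2})^2 \, d\mu_d$. *)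

theory Defs
  imports "HOL-Analysis.Analysis"
begin

definition densities :: "('a::euclidean_space \<Rightarrow> real) set" where
  "densities = {g. g \<in> borel_measurable borel \<and> (\<forall>x. 0 \<le> g x) \<and>
     (\<integral>\<^sup>+ x. ennreal (g x) \<partial>lborel) = 1}"

definition usc :: "('a::topological_space \<Rightarrow> ereal) \<Rightarrow> bool" where
  "usc \<phi> \<longleftrightarrow> (\<forall>x. Limsup (at x) \<phi> \<le> \<phi> x)"

text \<open>Only used for functions that never take the value \<open>\<infinity>\<close>, so that no sum
  \<open>\<infinity> + (-\<infinity>)\<close> occurs.\<close>

definition concave_ereal :: "('a::real_vector \<Rightarrow> ereal) \<Rightarrow> bool" where
  "concave_ereal \<phi> \<longleftrightarrow> (\<forall>x y. \<forall>t::real. 0 < t \<and> t < 1 \<longrightarrow>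
     ereal (1 - t) * \<phi> x + ereal t * \<phi> y \<le> \<phi> ((1 - t) *\<^sub>R x + t *\<^sub>R y))"

text \<open>The exponential on \<open>[-\<infinity>, \<infinity>)\<close>; the value at \<open>\<infinity>\<close> is irrelevant.\<close>

definition exp_ereal :: "ereal \<Rightarrow> real" where
  "exp_ereal u = (if u = -\<infinity> then 0 else exp (real_of_ereal u))"

definition log_concave_densities :: "('a::euclidean_space \<Rightarrow> real) set" where
  "log_concave_densities = {f \<in> densities. \<exists>\<phi>::'a \<Rightarrow> ereal.
     (\<forall>x. \<phi> x < \<infinity>) \<and> usc \<phi> \<and> concave_ereal \<phi> \<and> (\<forall>x. f x = exp_ereal (\<phi> x))}"

definition hellinger_sq :: "('a::euclidean_space \<Rightarrow> real) \<Rightarrow> ('a \<Rightarrow> real) \<Rightarrow> ennreal" where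
  "hellinger_sq f g = (\<integral>\<^sup>+ x. ennreal ((sqrt (f x) - sqrt (g x))\<^sup>2) \<partial>lborel)"

text \<open>The Borel \<open>\<sigma>\<close>-algebra of \<open>L\<^sub>1\<close>, generated by the sets that are open for the
  \<open>L\<^sub>1\<close> pseudometric on integrable functions. Such sets are closed under equality almost
  everywhere, so working with functions instead of equivalence classes (and, in
  \<^const>\<open>densities\<close>, with Borel measurable, everywhere nonnegative representatives)
  makes no difference.\<close>

definition L1_borel :: "('a::euclidean_space \<Rightarrow> real) measure" where
  "L1_borel = sigma {g. integrable lborel g}
     {U. U \<subseteq> {g. integrable lborel g} \<and>
         (\<forall>g\<in>U. \<exists>e>0. \<forall>k. integrable lborel k \<and>
            (LINT x|lborel. \<bar>g x - k x\<bar>) < e \<longrightarrow> k \<in> U)}"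

text \<open>A sample \<open>(X\<^sub>1, \<dots>, X\<^sub>n)\<close> is an element of the \<open>n\<close>-fold product, indexed by
  \<open>{..<n}\<close>.\<close>

definition estimators ::
    "nat \<Rightarrow> ((nat \<Rightarrow> 'a::euclidean_space) \<Rightarrow> ('a \<Rightarrow> real)) set" where
  "estimators n =
     measurable (Pi\<^sub>M {..<n} (\<lambda>_. borel)) (restrict_space L1_borel densities)"

text \<open>The law of \<open>n\<close> independent random vectors with density \<open>f\<close> is the product of the
  measures with density \<open>f\<close>.\<close>

definition sample_law :: "nat \<Rightarrow> ('a::euclidean_space \<Rightarrow> real) \<Rightarrow> (nat \<Rightarrow> 'a) measure" where
  "sample_law n f = Pi\<^sub>M {..<n} (\<lambda>_. density lborel (\<lambda>x. ennreal (f x)))"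

definition hellinger_risk ::
    "nat \<Rightarrow> ((nat \<Rightarrow> 'a::euclidean_space) \<Rightarrow> ('a \<Rightarrow> real)) \<Rightarrow> ('a \<Rightarrow> real) \<Rightarrow> ennreal" where
  "hellinger_risk n est f = (\<integral>\<^sup>+ x. hellinger_sq (est x) f \<partial>sample_law n f)"

end

theory Submission
  imports Defs
begin

text \<open>
  Perturb a base density on many disjoint cells, each of which carries a cap cut from the
  paraboloid \<open>t = |x|\<^sup>2\<close> by a shifted tangent hyperplane. All caps of width
  \<open>2\<epsilon>\<close> are equal up to a translation and a shear, so they have equal mass; the cells
  come in pairs, and in each pair exactly one of the two caps is cut. Hence all densities of
  the resulting hypercube have the same normalising constant. Cutting caps preserves convexity,
  hence log-concavity.

  In dimension \<open>d \<ge> 2\<close> take the uniform densities on the truncated paraboloids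
  \<open>w(x) \<le> t \<le> H\<close>, where \<open>w\<close> is the paraboloid with its caps cut: there are about \<open>\<epsilon>\<close> to the power \<open>-(d-1)\<close> cells,
  each of squared Hellinger size about \<open>\<epsilon>\<close> to the power \<open>d+1\<close>. In dimension 1 take the
  marginal densities, proportional to \<open>H - w(x)\<close>: there are about \<open>1/\<epsilon>\<close> cells, each
  of size about \<open>\<epsilon>\<close> to the power 5. If the size of a cell is of order \<open>1/n\<close>, then flipping one
  pair cannot be detected from a sample of size \<open>n\<close>, and averaging the risk over the hypercube
  (Assouad's lemma) bounds it below by the number of cells over \<open>n\<close>, up to a constant.
\<close>

section \<open>Log-concave densities, local Hellinger distance and the sampling law\<close>

text \<open>The exponent is \<open>ln g\<close> on \<open>K\<close> and \<open>-\<infinity>\<close>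
  elsewhere. Closedness of \<open>K\<close> and continuity of \<open>g\<close> give upper
  semi-continuity; concavity passes from \<open>g\<close> to \<open>ln g\<close> because
  \<open>ln\<close> is increasing and concave.\<close>

lemma log_concave_density_intro:
  fixes f :: "'a::euclidean_space \<Rightarrow> real"
  assumes f: "f \<in> densities" and K: "closed K" "convex K"
    and cont: "continuous_on K g" and conc: "concave_on K g" and pos: "\<And>x. x \<in> K \<Longrightarrow> g x > 0"
    and f_eq: "\<And>x. f x = (if x \<in> K then g x else 0)"
  shows "f \<in> log_concave_densities"
proof -
  define \<phi> :: "'a \<Rightarrow> ereal" where "\<phi> x = (if x \<in> K then ereal (ln (g x)) else -\<infinity>)" for x
  have lt: "\<phi> x < \<infinity>" for x
    by (simp add: \<phi>_def)
  have "Limsup (at x) \<phi> \<le> \<phi> x" for x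
  proof (cases "x \<in> K")
    case True
    \<comment> \<open>Near a point of \<open>K\<close> only neighbours in \<open>K\<close> matter,
      since the value elsewhere is \<open>-\<infinity>\<close>; on \<open>K\<close>, continuity of
      \<open>ln g\<close> keeps \<open>\<phi>\<close> below \<open>r\<close>.\<close>
    have "\<exists>d>0. \<forall>z. 0 < dist z x \<and> dist z x < d \<longrightarrow> \<phi> z < y" if y: "\<phi> x < y" for y
    proof -
      obtain r where r: "\<phi> x < ereal r" "ereal r < y"
        using ereal_dense2[OF y] by blast
      have "continuous_on K (\<lambda>x. ln (g x))"
        using cont pos by (intro continuous_on_ln) (auto simp: less_imp_neq[symmetric])
      moreover have "r - ln (g x) > 0"
        using r(1) True by (simp add: \<phi>_def)
      ultimately obtain d where d: "d > 0" "\<And>z. z \<in> K \<Longrightarrow> dist z x < d \<Longrightarrow> dist (ln (g z)) (ln (g x)) < r - ln (g x)"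
        using True unfolding continuous_on_iff by metis
      have "\<phi> z < ereal r" if "dist z x < d" for z
        using d(2)[of z] that by (auto simp: \<phi>_def dist_real_def)
      with d(1) r(2) show ?thesis
        by (intro exI[of _ d]) (auto intro: less_trans)
    qed
    then show ?thesis
      unfolding Limsup_le_iff eventually_at zero_less_dist_iff by simp
  next
    case False
    then obtain d where d: "d > 0" "ball x d \<subseteq> - K"
      using K(1) by (metis ComplI open_Compl open_contains_ball)
    have "eventually (\<lambda>z. \<phi> z \<le> -\<infinity>) (at x)"
      unfolding eventually_at using d by (auto simp: \<phi>_def dist_commute subset_iff intro!: exI[of _ d])
    from Limsup_bounded[OF this] have "Limsup (at x) \<phi> \<le> -\<infinity>" .
    moreover have "\<phi> x = -\<infinity>"
      using False by (simp add: \<phi>_def)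
    ultimately show ?thesis
      by simp
  qed
  then have usc: "usc \<phi>"
    by (simp add: usc_def)
  have "ereal (1 - t) * \<phi> x + ereal t * \<phi> y \<le> \<phi> ((1 - t) *\<^sub>R x + t *\<^sub>R y)"
    if t: "0 < t" "t < 1" for x y t
  proof (cases "x \<in> K \<and> y \<in> K")
    case True
    let ?z = "(1 - t) *\<^sub>R x + t *\<^sub>R y"
    have zK: "?z \<in> K"
      using True t K(2) by (simp add: convex_alt)
    have "(1 - t) * ln (g x) + t * ln (g y) \<le> ln ((1 - t) * g x + t * g y)"
      using concave_onD[OF ln_concave, of t "g x" "g y"] t pos True by simp
    also have "\<dots> \<le> ln (g ?z)"
    proof (rule ln_mono)
      show "(1 - t) * g x + t * g y > 0"
        using t pos True by (intro add_pos_pos mult_pos_pos) auto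
      show "(1 - t) * g x + t * g y \<le> g ?z"
        using concave_onD[OF conc, of t x y] t True by simp
    qed
    finally show ?thesis
      using True zK by (simp add: \<phi>_def)
  next
    \<comment> \<open>A positive weight times \<open>-\<infinity>\<close> is
      \<open>-\<infinity>\<close>, so the left-hand side is \<open>-\<infinity>\<close>.\<close>
    case False
    then show ?thesis
      using t by (auto simp: \<phi>_def)
  qed
  then have "concave_ereal \<phi>"
    by (simp add: concave_ereal_def)
  moreover have "f x = exp_ereal (\<phi> x)" for x
    using pos[of x] f_eq[of x] by (simp add: \<phi>_def exp_ereal_def)
  ultimately show ?thesis
    using f lt usc by (auto simp: log_concave_densities_def)
qed

section \<open>Elementary inequalities for squares and square roots\<close>

lemma sqrt_diff_sq_le:
  fixes a b :: real
  assumes "a \<ge> 0" "b \<ge> 0"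
  shows "(sqrt a - sqrt b)\<^sup>2 \<le> \<bar>a - b\<bar>"
proof -
  have "(sqrt a - sqrt b)\<^sup>2 = \<bar>sqrt a - sqrt b\<bar> * \<bar>sqrt a - sqrt b\<bar>"
    by (simp add: power2_eq_square)
  also have "\<dots> \<le> \<bar>sqrt a - sqrt b\<bar> * \<bar>sqrt a + sqrt b\<bar>"
    using real_sqrt_ge_zero[OF assms(1)] real_sqrt_ge_zero[OF assms(2)]
    by (intro mult_left_mono) linarith+
  also have "\<dots> = \<bar>(sqrt a)\<^sup>2 - (sqrt b)\<^sup>2\<bar>"
    by (simp only: abs_mult[symmetric]) (simp add: power2_eq_square algebra_simps)
  also have "\<dots> = \<bar>a - b\<bar>"
    using assms by simp
  finally show ?thesis .
qed

text \<open>Rationalise: the sum of the roots is at most \<open>2 * sqrt h\<close>. For bounded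
  functions this turns a pointwise gap into a lower bound on the Hellinger size of a cell.\<close>

lemma sqrt_diff_sq_ge:
  fixes a b h :: real
  assumes "0 \<le> b" "b \<le> a" "a \<le> h" "h > 0"
  shows "(a - b)\<^sup>2 / (4 * h) \<le> (sqrt a - sqrt b)\<^sup>2"
proof -
  have "sqrt a + sqrt b \<le> 2 * sqrt h" "0 \<le> sqrt a + sqrt b"
    using assms real_sqrt_le_mono[of a h] real_sqrt_le_mono[of b h]
      real_sqrt_ge_zero[of a] real_sqrt_ge_zero[of b] by linarith+
  then have "(sqrt a + sqrt b)\<^sup>2 \<le> (2 * sqrt h)\<^sup>2"
    by (rule power_mono)
  also have "\<dots> = 4 * h"
    using assms by (simp add: power_mult_distrib)
  finally have le: "(sqrt a + sqrt b)\<^sup>2 \<le> 4 * h" .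
  have "(a - b)\<^sup>2 = ((sqrt a)\<^sup>2 - (sqrt b)\<^sup>2)\<^sup>2"
    using assms by simp
  also have "\<dots> = (sqrt a - sqrt b)\<^sup>2 * (sqrt a + sqrt b)\<^sup>2"
    by (simp add: power2_eq_square algebra_simps)
  also have "\<dots> \<le> (sqrt a - sqrt b)\<^sup>2 * (4 * h)"
    using le by (intro mult_left_mono) auto
  finally show ?thesis
    using assms by (simp add: field_simps)
qed

text \<open>For values at least 1 the sum of the roots is at least 1. This makes the upper bound for
  a cell quadratic rather than linear in the gap.\<close>

lemma sqrt_diff_sq_le_sq:
  fixes a b :: real
  assumes "1 \<le> b" "b \<le> a"
  shows "(sqrt a - sqrt b)\<^sup>2 \<le> (a - b)\<^sup>2"
proof -
  have ge: "1 \<le> sqrt a + sqrt b" "0 \<le> sqrt a - sqrt b"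
    using assms real_sqrt_ge_one[of b] real_sqrt_ge_one[of a] real_sqrt_le_mono[of b a] by linarith+
  have "(sqrt a - sqrt b) * 1 \<le> (sqrt a - sqrt b) * (sqrt a + sqrt b)"
    using ge by (intro mult_left_mono) auto
  also have "\<dots> = (sqrt a)\<^sup>2 - (sqrt b)\<^sup>2"
    by (simp add: power2_eq_square algebra_simps)
  also have "\<dots> = a - b"
    using assms by simp
  finally show ?thesis
    using ge by (intro power_mono) auto
qed

text \<open>Young's inequality with a free weight. Small \<open>t\<close> gives openness of
  Hellinger sublevel sets; \<open>t = 1\<close> gives the triangle inequality for squares.\<close>

lemma add_sq_le_weighted:
  fixes a b t :: real
  assumes "t > 0"
  shows "(a + b)\<^sup>2 \<le> (1 + t) * a\<^sup>2 + (1 + 1 / t) * b\<^sup>2"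
proof -
  have "(1 + t) * a\<^sup>2 + (1 + 1 / t) * b\<^sup>2 - (a + b)\<^sup>2 = (t * a - b)\<^sup>2 / t"
    using assms by (simp add: power2_eq_square field_simps)
  also have "\<dots> \<ge> 0"
    using assms by simp
  finally show ?thesis by simp
qed

section \<open>Hellinger distance restricted to a set\<close>

definition hellinger_on :: "'a::euclidean_space set \<Rightarrow> ('a \<Rightarrow> real) \<Rightarrow> ('a \<Rightarrow> real) \<Rightarrow> ennreal" where
  "hellinger_on A g f = (\<integral>\<^sup>+ y\<in>A. ennreal ((sqrt (g y) - sqrt (f y))\<^sup>2) \<partial>lborel)"

lemma densitiesD:
  assumes "f \<in> densities"
  shows "f \<in> borel_measurable borel" "\<And>x. 0 \<le> f x" "(\<integral>\<^sup>+ x. ennreal (f x) \<partial>lborel) = 1"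
    "integrable lborel f"
proof -
  show 1: "f \<in> borel_measurable borel" "\<And>x. 0 \<le> f x" "(\<integral>\<^sup>+ x. ennreal (f x) \<partial>lborel) = 1"
    using assms by (auto simp: densities_def)
  then show "integrable lborel f"
    by (intro integrableI_nonneg) (auto simp: 1)
qed

text \<open>The new error is controlled in \<open>L1\<close> by \<open>sqrt_diff_sq_le\<close>,
  while Young's inequality keeps the factor on the old distance close to 1. The absolute values are
  there because \<open>L1_borel\<close> lives on all integrable functions, not only on nonnegative
  ones.\<close>

lemma hellinger_on_perturb:
  fixes f g k :: "'a::euclidean_space \<Rightarrow> real"
  assumes [measurable]: "A \<in> sets borel" "f \<in> borel_measurable borel"
    and gk: "integrable lborel g" "integrable lborel k" and t: "t > 0"
  shows "hellinger_on A (\<lambda>y. \<bar>k y\<bar>) f \<le> ennreal (1 + t) * hellinger_on A (\<lambda>y. \<bar>g y\<bar>) f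
      + ennreal ((1 + 1 / t) * (LINT y|lborel. \<bar>g y - k y\<bar>))"
proof -
  have [measurable]: "g \<in> borel_measurable borel" "k \<in> borel_measurable borel"
    using gk[THEN borel_measurable_integrable] by simp_all
  have "(sqrt \<bar>k y\<bar> - sqrt (f y))\<^sup>2 \<le> (1 + t) * (sqrt \<bar>g y\<bar> - sqrt (f y))\<^sup>2 + (1 + 1 / t) * \<bar>g y - k y\<bar>" for y
  proof -
    have "(sqrt \<bar>k y\<bar> - sqrt (f y))\<^sup>2 = ((sqrt \<bar>g y\<bar> - sqrt (f y)) + (sqrt \<bar>k y\<bar> - sqrt \<bar>g y\<bar>))\<^sup>2"
      by simp
    also have "\<dots> \<le> (1 + t) * (sqrt \<bar>g y\<bar> - sqrt (f y))\<^sup>2 + (1 + 1 / t) * (sqrt \<bar>k y\<bar> - sqrt \<bar>g y\<bar>)\<^sup>2"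
      by (rule add_sq_le_weighted[OF t])
    also have "\<dots> \<le> (1 + t) * (sqrt \<bar>g y\<bar> - sqrt (f y))\<^sup>2 + (1 + 1 / t) * \<bar>g y - k y\<bar>"
      using t sqrt_diff_sq_le[of "\<bar>k y\<bar>" "\<bar>g y\<bar>"]
      by (intro add_left_mono mult_left_mono) auto
    finally show ?thesis .
  qed
  then have "hellinger_on A (\<lambda>y. \<bar>k y\<bar>) f \<le> (\<integral>\<^sup>+ y. ennreal (1 + t) * (ennreal ((sqrt \<bar>g y\<bar> - sqrt (f y))\<^sup>2) * indicator A y)
      + ennreal (1 + 1 / t) * ennreal \<bar>g y - k y\<bar> \<partial>lborel)"
    unfolding hellinger_on_def using t
    by (intro nn_integral_mono)
       (auto simp: ennreal_mult[symmetric] ennreal_plus[symmetric] simp del: ennreal_plus split: split_indicator)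
  also have "\<dots> = ennreal (1 + t) * hellinger_on A (\<lambda>y. \<bar>g y\<bar>) f
      + ennreal (1 + 1 / t) * (\<integral>\<^sup>+ y. ennreal \<bar>g y - k y\<bar> \<partial>lborel)"
    unfolding hellinger_on_def by (simp add: nn_integral_add nn_integral_cmult)
  also have "(\<integral>\<^sup>+ y. ennreal \<bar>g y - k y\<bar> \<partial>lborel) = ennreal (LINT y|lborel. \<bar>g y - k y\<bar>)"
    using gk by (intro nn_integral_eq_integral) auto
  finally show ?thesis
    using t by (simp add: ennreal_mult)
qed

text \<open>The sublevel set is open for the \<open>L1\<close> pseudometric, hence a generator of
  the \<open>\<sigma>\<close>-algebra.\<close>

lemma sublevel_hellinger_on_L1_borel:
  fixes f :: "'a::euclidean_space \<Rightarrow> real"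
  assumes A: "A \<in> sets borel" and f: "f \<in> borel_measurable borel"
  shows "{g. integrable lborel g \<and> hellinger_on A (\<lambda>y. \<bar>g y\<bar>) f < a} \<in> sets L1_borel"
proof -
  let ?U = "{g. integrable lborel g \<and> hellinger_on A (\<lambda>y. \<bar>g y\<bar>) f < a}"
  let ?H = "\<lambda>g. hellinger_on A (\<lambda>y. \<bar>g y\<bar>) f"
  have "\<exists>e>0. \<forall>k. integrable lborel k \<and> (LINT x|lborel. \<bar>g x - k x\<bar>) < e \<longrightarrow> k \<in> ?U" if g: "g \<in> ?U" for g
  proof -
    obtain b where b: "?H g < b" "b < a"
      using g dense by blast
    obtain r where r: "?H g = ennreal r" "r \<ge> 0"
      using b by (cases "?H g") auto
    obtain b' where b': "b = ennreal b'" "b' \<ge> 0"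
      using b by (cases b) (auto simp: top.not_eq_extremum)
    have rb: "r < b'"
      using b r b' by (simp add: ennreal_less_iff)
    \<comment> \<open>The gap \<open>b' - r\<close> is split in halves: \<open>t * r\<close> uses at
      most one, the \<open>L1\<close> radius \<open>e\<close> the other. The \<open>+ 1\<close>
      covers \<open>r = 0\<close>.\<close>
    define t where "t = (b' - r) / (2 * (r + 1))"
    have t: "t > 0" "t * r \<le> (b' - r) / 2"
      using rb r(2) by (auto simp: t_def field_simps mult_nonneg_nonneg)
    define c where "c = 1 + 1 / t"
    have c: "c > 0"
      using t(1) by (simp add: c_def add_pos_pos)
    define e where "e = (b' - r) / 2 / c"
    have e: "e > 0" "(1 + 1 / t) * e = (b' - r) / 2"
      unfolding c_def[symmetric] using rb c by (auto simp: e_def)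
    have "?H k < a" if k: "integrable lborel k" "(LINT x|lborel. \<bar>g x - k x\<bar>) < e" for k
    proof -
      have "?H k \<le> ennreal (1 + t) * ?H g + ennreal ((1 + 1 / t) * (LINT y|lborel. \<bar>g y - k y\<bar>))"
        using g k t by (intro hellinger_on_perturb A f) auto
      also have "\<dots> \<le> ennreal (1 + t) * ennreal r + ennreal ((1 + 1 / t) * e)"
        unfolding r(1) using k t by (intro add_left_mono ennreal_leI mult_left_mono) auto
      also have "\<dots> = ennreal ((1 + t) * r + (1 + 1 / t) * e)"
        using t r e by (simp add: ennreal_mult[symmetric] ennreal_plus[symmetric] del: ennreal_plus)
      also have "\<dots> \<le> ennreal b'"
        using t e by (intro ennreal_leI) (simp add: algebra_simps)
      finally show ?thesis
        using b b' by simp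
    qed
    with e(1) show ?thesis
      by (intro exI[of _ e]) auto
  qed
  then have "?U \<in> {U. U \<subseteq> {g. integrable lborel g} \<and>
         (\<forall>g\<in>U. \<exists>e>0. \<forall>k. integrable lborel k \<and> (LINT x|lborel. \<bar>g x - k x\<bar>) < e \<longrightarrow> k \<in> U)}"
    by blast
  then show ?thesis
    unfolding L1_borel_def by (subst sets_measure_of) (auto intro: sigma_sets.Basic)
qed

text \<open>On \<open>densities\<close> the absolute values vanish, so the sublevel sets are traces
  of the open sets above. This makes the local losses of an estimator measurable.\<close>

lemma measurable_hellinger_on:
  fixes f :: "'a::euclidean_space \<Rightarrow> real"
  assumes A: "A \<in> sets borel" and f: "f \<in> borel_measurable borel"
  shows "(\<lambda>g. hellinger_on A g f) \<in> borel_measurable (restrict_space L1_borel densities)"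
proof (rule borel_measurableI_less)
  fix a :: ennreal
  have sp: "space (restrict_space L1_borel densities :: ('a \<Rightarrow> real) measure) = densities"
    by (auto simp: space_restrict_space L1_borel_def space_measure_of_conv densitiesD)
  have "{g \<in> densities. hellinger_on A g f < a}
      = densities \<inter> {g. integrable lborel g \<and> hellinger_on A (\<lambda>y. \<bar>g y\<bar>) f < a}"
    by (auto simp: densitiesD)
  also have "\<dots> \<in> sets (restrict_space L1_borel densities)"
    unfolding sets_restrict_space using sublevel_hellinger_on_L1_borel[OF A f] by blast
  finally show "{g \<in> space (restrict_space L1_borel densities). hellinger_on A g f < a}
      \<in> sets (restrict_space L1_borel densities)"
    unfolding sp .
qed

text \<open>Checked on rectangles, where both sides factor over the coordinates. It puts all sample
  laws over one reference measure, so that their densities can be compared pointwise.\<close>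

lemma sample_law_eq_density:
  fixes f :: "'a::euclidean_space \<Rightarrow> real"
  assumes f: "f \<in> densities"
  shows "sample_law n f = density (Pi\<^sub>M {..<n} (\<lambda>_. lborel)) (\<lambda>x. \<Prod>i<n. ennreal (f (x i)))"
proof -
  note [measurable] = densitiesD(1)[OF f]
  interpret L: product_sigma_finite "\<lambda>_. lborel :: 'a measure"
    by standard
  have "finite_measure (density lborel (\<lambda>x. ennreal (f x)))"
    by (rule finite_measureI) (simp add: emeasure_density densitiesD[OF f])
  then interpret P: product_sigma_finite "\<lambda>_. density lborel (\<lambda>x. ennreal (f x))"
    by (simp add: product_sigma_finite_def finite_measure_def)
  show ?thesis
    unfolding sample_law_def
  proof (rule P.PiM_eqI[symmetric])
    show "sets (density (Pi\<^sub>M {..<n} (\<lambda>_. lborel)) (\<lambda>x. \<Prod>i<n. ennreal (f (x i))))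
      = sets (Pi\<^sub>M {..<n} (\<lambda>_. density lborel (\<lambda>x. ennreal (f x))))"
      by (simp cong: sets_PiM_cong)
    fix A :: "nat \<Rightarrow> 'a set"
    assume "\<And>i. i \<in> {..<n} \<Longrightarrow> A i \<in> sets (density lborel (\<lambda>x. ennreal (f x)))"
    then have A[measurable]: "\<And>i. i \<in> {..<n} \<Longrightarrow> A i \<in> sets borel"
      by simp
    have "emeasure (density (Pi\<^sub>M {..<n} (\<lambda>_. lborel)) (\<lambda>x. \<Prod>i<n. ennreal (f (x i)))) (Pi\<^sub>E {..<n} A)
      = (\<integral>\<^sup>+ x. (\<Prod>i<n. ennreal (f (x i))) * indicator (Pi\<^sub>E {..<n} A) x \<partial>Pi\<^sub>M {..<n} (\<lambda>_. lborel))"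
      using A by (intro emeasure_density) (auto intro!: sets_PiM_I_finite)
    also have "\<dots> = (\<integral>\<^sup>+ x. (\<Prod>i<n. ennreal (f (x i)) * indicator (A i) (x i)) \<partial>Pi\<^sub>M {..<n} (\<lambda>_. lborel))"
    proof (rule nn_integral_cong)
      fix x assume "x \<in> space (Pi\<^sub>M {..<n} (\<lambda>_. lborel :: 'a measure))"
      then have x: "x \<in> extensional {..<n}"
        by (auto simp: space_PiM PiE_def)
      show "(\<Prod>i<n. ennreal (f (x i))) * indicator (Pi\<^sub>E {..<n} A) x
        = (\<Prod>i<n. ennreal (f (x i)) * indicator (A i) (x i))"
      proof (cases "x \<in> Pi\<^sub>E {..<n} A")
        case True
        then have "x i \<in> A i" if "i < n" for i
          using that by (simp add: PiE_iff)
        with True show ?thesis by simp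
      next
        \<comment> \<open>A point of the space is extensional, so outside the rectangle some
          coordinate below \<open>n\<close> leaves its factor, and the product vanishes.\<close>
        case False
        then obtain i where "i < n" "x i \<notin> A i"
          using x unfolding PiE_iff by blast
        then have "(\<Prod>i<n. ennreal (f (x i)) * indicator (A i) (x i)) = 0"
          by (intro prod_zero) (auto intro!: bexI[of _ i])
        then show ?thesis
          using False by simp
      qed
    qed
    also have "\<dots> = (\<Prod>i<n. \<integral>\<^sup>+ y. ennreal (f y) * indicator (A i) y \<partial>lborel)"
      by (rule L.product_nn_integral_prod) auto
    also have "\<dots> = (\<Prod>i<n. emeasure (density lborel (\<lambda>x. ennreal (f x))) (A i))"
      by (intro prod.cong refl emeasure_density[symmetric]) auto
    finally show "emeasure (density (Pi\<^sub>M {..<n} (\<lambda>_. lborel)) (\<lambda>x. \<Prod>i<n. ennreal (f (x i)))) (Pi\<^sub>E {..<n} A)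
      = (\<Prod>i<n. emeasure (density lborel (\<lambda>x. ennreal (f x))) (A i))" .
  qed simp
qed

section \<open>The two-point bound\<close>

text \<open>Expanding the square, \<open>hellinger_sq\<close> plus twice the affinity is 2, the
  total mass of both densities.\<close>

lemma affinity_ge:
  fixes f f' :: "'a::euclidean_space \<Rightarrow> real"
  assumes f: "f \<in> densities" "f' \<in> densities" and \<Gamma>: "0 \<le> \<Gamma>"
    and h: "hellinger_sq f f' \<le> ennreal (2 * \<Gamma>)"
  shows "ennreal (1 - \<Gamma>) \<le> (\<integral>\<^sup>+ y. ennreal (sqrt (f y * f' y)) \<partial>lborel)"
proof -
  note [measurable] = f[THEN densitiesD(1)]
  let ?r = "\<integral>\<^sup>+ y. ennreal (sqrt (f y * f' y)) \<partial>lborel"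
  have "hellinger_sq f f' + 2 * ?r
      = (\<integral>\<^sup>+ y. ennreal ((sqrt (f y) - sqrt (f' y))\<^sup>2) + 2 * ennreal (sqrt (f y * f' y)) \<partial>lborel)"
    unfolding hellinger_sq_def by (simp add: nn_integral_add nn_integral_cmult)
  also have "\<dots> = (\<integral>\<^sup>+ y. ennreal (f y) + ennreal (f' y) \<partial>lborel)"
  proof (rule nn_integral_cong)
    fix y
    have pos: "f y \<ge> 0" "f' y \<ge> 0"
      using f by (auto simp: densitiesD)
    have "ennreal ((sqrt (f y) - sqrt (f' y))\<^sup>2) + 2 * ennreal (sqrt (f y * f' y))
        = ennreal ((sqrt (f y) - sqrt (f' y))\<^sup>2 + 2 * sqrt (f y * f' y))"
      using pos by (simp add: ennreal_plus ennreal_mult)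
    also have "(sqrt (f y) - sqrt (f' y))\<^sup>2 + 2 * sqrt (f y * f' y) = f y + f' y"
      using pos by (simp add: power2_diff real_sqrt_mult)
    finally show "ennreal ((sqrt (f y) - sqrt (f' y))\<^sup>2) + 2 * ennreal (sqrt (f y * f' y)) = ennreal (f y) + ennreal (f' y)"
      using pos by simp
  qed
  also have "\<dots> = 2"
    by (simp add: nn_integral_add densitiesD[OF f(1)] densitiesD[OF f(2)])
  finally have "2 \<le> ennreal (2 * \<Gamma>) + 2 * ?r"
    using h by (metis add_right_mono)
  then show ?thesis
  proof (cases ?r)
    case (real r)
    with \<open>2 \<le> ennreal (2 * \<Gamma>) + 2 * ?r\<close> have "ennreal 2 \<le> ennreal (2 * \<Gamma> + 2 * r)"
      using \<Gamma> by (simp add: ennreal_mult)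
    then have "2 \<le> 2 * \<Gamma> + 2 * r"
      using \<Gamma> real by (subst (asm) ennreal_le_iff) auto
    then show ?thesis
      using real by (auto intro: ennreal_leI)
  qed simp
qed

text \<open>Expand \<open>0 \<le> (sqrt a - sqrt b / 2)^2\<close> with the smaller number in the
  role of \<open>a\<close>. Integrated over two probability densities, this bounds the affinity by
  the integral of the minimum plus 1/2, a linear substitute for Cauchy-Schwarz.\<close>

lemma sqrt_mult_le_min:
  fixes a b :: real
  assumes "a \<ge> 0" "b \<ge> 0"
  shows "sqrt (a * b) \<le> min a b + (a + b) / 4"
proof -
  have *: "sqrt (a * b) \<le> a + b / 4" if "a \<ge> 0" "b \<ge> 0" for a b :: real
  proof -
    have "0 \<le> (sqrt a - sqrt b / 2)\<^sup>2"
      by simp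
    also have "\<dots> = a + b / 4 - sqrt (a * b)"
      using that by (simp add: power2_diff power_divide real_sqrt_mult)
    finally show ?thesis by simp
  qed
  from *[OF assms] *[OF assms(2,1)] show ?thesis
    using assms by (auto simp: min_def mult.commute add_divide_distrib)
qed

text \<open>The affinity of the product densities is an \<open>n\<close>-th power, at least
  \<open>(1 - \<Gamma>) ^ n \<ge> 3 / 4\<close> by Bernoulli. By \<open>sqrt_mult_le_min\<close> the
  minimum then has integral at least 3/4 - 1/2.\<close>

lemma min_sample_density_ge:
  fixes f f' :: "'a::euclidean_space \<Rightarrow> real"
  assumes f: "f \<in> densities" "f' \<in> densities" and \<Gamma>: "0 \<le> \<Gamma>" "real n * \<Gamma> \<le> 1 / 4"
    and h: "hellinger_sq f f' \<le> ennreal (2 * \<Gamma>)"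
  shows "1 / 4 \<le> (\<integral>\<^sup>+ x. min (\<Prod>i<n. ennreal (f (x i))) (\<Prod>i<n. ennreal (f' (x i))) \<partial>Pi\<^sub>M {..<n} (\<lambda>_. lborel))"
    (is "_ \<le> ?I")
proof (cases "n = 0")
  \<comment> \<open>For \<open>n = 0\<close> both products are empty and the minimum is 1 on a
    one-point space. In the other case \<open>n \<ge> 1\<close> yields
    \<open>\<Gamma> \<le> 1\<close>.\<close>
  case True
  interpret L: product_sigma_finite "\<lambda>_::nat. lborel :: 'a measure"
    by standard
  show ?thesis
    using True L.nn_integral_empty[of "\<lambda>_. 1"] by (simp add: divide_le_posI_ennreal)
next
  case False
  interpret L: product_sigma_finite "\<lambda>_::nat. lborel :: 'a measure"
    by standard
  note [measurable] = f[THEN densitiesD(1)]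
  let ?M = "Pi\<^sub>M {..<n} (\<lambda>_. lborel :: 'a measure)"
  have pos: "f y \<ge> 0" "f' y \<ge> 0" for y
    using f by (auto simp: densitiesD)
  have \<Gamma>1: "\<Gamma> \<le> 1"
  proof -
    have "1 * \<Gamma> \<le> real n * \<Gamma>"
      using False \<Gamma> by (intro mult_right_mono) auto
    with \<Gamma> show ?thesis by simp
  qed
  have "3 / 4 \<le> (1 - \<Gamma>) ^ n"
    using Bernoulli_inequality[of "- \<Gamma>" n] \<Gamma> \<Gamma>1 by simp
  then have "ennreal (3 / 4) \<le> ennreal (1 - \<Gamma>) ^ n"
    using \<Gamma>1 by (simp add: ennreal_power ennreal_leI)
  also have "\<dots> \<le> (\<integral>\<^sup>+ y. ennreal (sqrt (f y * f' y)) \<partial>lborel) ^ n"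
    by (intro power_mono affinity_ge f \<Gamma> h) simp
  also have "\<dots> = (\<integral>\<^sup>+ x. (\<Prod>i<n. ennreal (sqrt (f (x i) * f' (x i)))) \<partial>?M)"
    by (subst L.product_nn_integral_prod) auto
  also have "\<dots> \<le> (\<integral>\<^sup>+ x. min (\<Prod>i<n. ennreal (f (x i))) (\<Prod>i<n. ennreal (f' (x i)))
      + ennreal (1 / 4) * ((\<Prod>i<n. ennreal (f (x i))) + (\<Prod>i<n. ennreal (f' (x i)))) \<partial>?M)"
  proof (rule nn_integral_mono)
    fix x
    let ?p = "\<Prod>i<n. f (x i)" and ?q = "\<Prod>i<n. f' (x i)"
    have pq: "?p \<ge> 0" "?q \<ge> 0"
      using pos by (auto intro!: prod_nonneg)
    have "sqrt (?p * ?q) \<le> min ?p ?q + 1 / 4 * (?p + ?q)"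
      using sqrt_mult_le_min[OF pq] by simp
    moreover have "(\<Prod>i<n. sqrt (f (x i) * f' (x i))) = sqrt (?p * ?q)"
      unfolding prod.distrib[symmetric] by (induction n) (simp_all add: real_sqrt_mult)
    ultimately have "ennreal (\<Prod>i<n. sqrt (f (x i) * f' (x i))) \<le> ennreal (min ?p ?q + 1 / 4 * (?p + ?q))"
      by (simp add: ennreal_leI)
    also have "\<dots> = ennreal (min ?p ?q) + ennreal (1 / 4) * (ennreal ?p + ennreal ?q)"
      using pq by (simp add: ennreal_plus[symmetric] ennreal_mult[symmetric] del: ennreal_plus)
    also have "ennreal (min ?p ?q) = min (ennreal ?p) (ennreal ?q)"
      using pq by (auto simp: min_def ennreal_le_iff)
    finally show "(\<Prod>i<n. ennreal (sqrt (f (x i) * f' (x i)))) \<le> min (\<Prod>i<n. ennreal (f (x i))) (\<Prod>i<n. ennreal (f' (x i)))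
      + ennreal (1 / 4) * ((\<Prod>i<n. ennreal (f (x i))) + (\<Prod>i<n. ennreal (f' (x i))))"
      using pos by (simp add: prod_ennreal)
  qed
  also have "\<dots> = ?I + ennreal (1 / 4) * ((\<integral>\<^sup>+ x. (\<Prod>i<n. ennreal (f (x i))) \<partial>?M) + (\<integral>\<^sup>+ x. (\<Prod>i<n. ennreal (f' (x i))) \<partial>?M))"
    by (simp add: nn_integral_add nn_integral_cmult)
  also have "(\<integral>\<^sup>+ x. (\<Prod>i<n. ennreal (f (x i))) \<partial>?M) = 1"
    by (subst L.product_nn_integral_prod) (auto simp: densitiesD[OF f(1)])
  also have "(\<integral>\<^sup>+ x. (\<Prod>i<n. ennreal (f' (x i))) \<partial>?M) = 1"
    by (subst L.product_nn_integral_prod) (auto simp: densitiesD[OF f(2)])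
  finally have le: "ennreal (3 / 4) \<le> ?I + ennreal (1 / 4) * (1 + 1)" .
  have "ennreal (1 / 4) \<le> ?I"
  proof (cases ?I)
    case (real r)
    have "ennreal (1 / 4) * (1 + 1) = ennreal (1 / 4) * ennreal 2"
      by simp
    also have "\<dots> = ennreal (1 / 2)"
      by (subst ennreal_mult[symmetric]) auto
    finally have "ennreal (3 / 4) \<le> ennreal r + ennreal (1 / 2)"
      using le real by metis
    then have "ennreal (3 / 4) \<le> ennreal (r + 1 / 2)"
      using real by (subst ennreal_plus) auto
    then have "3 / 4 \<le> r + 1 / 2"
      using real by (subst (asm) ennreal_le_iff) auto
    then show ?thesis
      using real by (auto intro: ennreal_leI)
  qed simp
  also have "ennreal (1 / 4) = 1 / 4"
    by (subst ennreal_divide_numeral[symmetric]) auto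
  finally show ?thesis .
qed

text \<open>Le Cam's argument: for sample densities \<open>p\<close> and \<open>p'\<close>,
  \<open>p * u + p' * u' \<ge> min p p' * (u + u')\<close>, and the minimum has integral at least
  1/4.\<close>

lemma two_point_bound:
  fixes f f' :: "'a::euclidean_space \<Rightarrow> real"
  assumes f: "f \<in> densities" "f' \<in> densities" and \<Gamma>: "0 \<le> \<Gamma>" "real n * \<Gamma> \<le> 1 / 4"
    and h: "hellinger_sq f f' \<le> ennreal (2 * \<Gamma>)"
    and u[measurable]: "u \<in> borel_measurable (Pi\<^sub>M {..<n} (\<lambda>_. borel))"
    and u'[measurable]: "u' \<in> borel_measurable (Pi\<^sub>M {..<n} (\<lambda>_. borel))"
    and ge: "\<And>x. x \<in> space (Pi\<^sub>M {..<n} (\<lambda>_. borel)) \<Longrightarrow> \<gamma> \<le> u x + u' x"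
  shows "\<gamma> / 4 \<le> (\<integral>\<^sup>+ x. u x \<partial>sample_law n f) + (\<integral>\<^sup>+ x. u' x \<partial>sample_law n f')"
proof -
  note [measurable] = f[THEN densitiesD(1)]
  let ?M = "Pi\<^sub>M {..<n} (\<lambda>_. lborel :: 'a measure)"
  let ?p = "\<lambda>f x. \<Prod>i<n. ennreal (f (x i :: 'a))"
  have sets_M[measurable_cong]: "sets ?M = sets (Pi\<^sub>M {..<n} (\<lambda>_. borel))"
    by (simp cong: sets_PiM_cong)
  have sp: "space ?M = space (Pi\<^sub>M {..<n} (\<lambda>_. borel))"
    by (rule sets_eq_imp_space_eq[OF sets_M])
  have "\<gamma> / 4 = \<gamma> * (1 / 4)"
    by (simp add: divide_ennreal_def)
  also have "\<dots> \<le> \<gamma> * (\<integral>\<^sup>+ x. min (?p f x) (?p f' x) \<partial>?M)"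
    by (intro mult_left_mono min_sample_density_ge[OF f \<Gamma> h]) simp
  also have "\<dots> = (\<integral>\<^sup>+ x. \<gamma> * min (?p f x) (?p f' x) \<partial>?M)"
    by (rule nn_integral_cmult[symmetric]) measurable
  also have "\<dots> \<le> (\<integral>\<^sup>+ x. ?p f x * u x + ?p f' x * u' x \<partial>?M)"
  proof (rule nn_integral_mono)
    fix x assume "x \<in> space ?M"
    then have "\<gamma> * min (?p f x) (?p f' x) \<le> (u x + u' x) * min (?p f x) (?p f' x)"
      using ge sp by (intro mult_right_mono) auto
    also have "\<dots> = min (?p f x) (?p f' x) * u x + min (?p f x) (?p f' x) * u' x"
      by (simp add: distrib_right mult.commute)
    also have "\<dots> \<le> ?p f x * u x + ?p f' x * u' x"
      by (intro add_mono mult_right_mono) auto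
    finally show "\<gamma> * min (?p f x) (?p f' x) \<le> ?p f x * u x + ?p f' x * u' x" .
  qed
  also have "\<dots> = (\<integral>\<^sup>+ x. ?p f x * u x \<partial>?M) + (\<integral>\<^sup>+ x. ?p f' x * u' x \<partial>?M)"
    by (rule nn_integral_add) measurable
  also have "\<dots> = (\<integral>\<^sup>+ x. u x \<partial>sample_law n f) + (\<integral>\<^sup>+ x. u' x \<partial>sample_law n f')"
    unfolding sample_law_eq_density[OF f(1)] sample_law_eq_density[OF f(2)]
    by (subst (1 2) nn_integral_density) measurable
  finally show ?thesis .
qed

lemma hellinger_on_triangle:
  fixes f g k :: "'a::euclidean_space \<Rightarrow> real"
  assumes [measurable]: "A \<in> sets borel" "f \<in> borel_measurable borel" "g \<in> borel_measurable borel"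
    "k \<in> borel_measurable borel"
  shows "hellinger_on A f k \<le> 2 * (hellinger_on A g f + hellinger_on A g k)"
proof -
  have "(sqrt (f y) - sqrt (k y))\<^sup>2 \<le> 2 * ((sqrt (g y) - sqrt (f y))\<^sup>2 + (sqrt (g y) - sqrt (k y))\<^sup>2)" for y
    using add_sq_le_weighted[of 1 "sqrt (f y) - sqrt (g y)" "sqrt (g y) - sqrt (k y)"]
    by (simp add: power2_commute[of "sqrt (f y)" "sqrt (g y)"])
  then have "hellinger_on A f k \<le> (\<integral>\<^sup>+ y. 2 * (ennreal ((sqrt (g y) - sqrt (f y))\<^sup>2) * indicator A y
      + ennreal ((sqrt (g y) - sqrt (k y))\<^sup>2) * indicator A y) \<partial>lborel)"
    unfolding hellinger_on_def
    by (intro nn_integral_mono) (auto simp: ennreal_plus[symmetric] ennreal_mult'[symmetric]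
        numeral_mult_ennreal simp del: ennreal_plus split: split_indicator intro!: ennreal_leI)
  also have "\<dots> = 2 * (hellinger_on A g f + hellinger_on A g k)"
    unfolding hellinger_on_def by (simp add: nn_integral_add nn_integral_cmult)
  finally show ?thesis .
qed

section \<open>Assouad's lemma for patched densities\<close>

lemma hellinger_on_cong:
  assumes "\<And>y. y \<in> A \<Longrightarrow> g y = g' y" "\<And>y. y \<in> A \<Longrightarrow> f y = f' y"
  shows "hellinger_on A g f = hellinger_on A g' f'"
  unfolding hellinger_on_def using assms by (intro nn_integral_cong) (auto split: split_indicator)

lemma hellinger_on_commute: "hellinger_on A f g = hellinger_on A g f"
  by (simp add: hellinger_on_def power2_commute)

lemma hellinger_on_union:
  assumes [measurable]: "A \<in> sets borel" "B \<in> sets borel" "f \<in> borel_measurable borel" "g \<in> borel_measurable borel"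
    and disj: "A \<inter> B = {}"
  shows "hellinger_on (A \<union> B) f g = hellinger_on A f g + hellinger_on B f g"
  unfolding hellinger_on_def
  by (subst nn_integral_add[symmetric]) (use disj in \<open>auto intro!: nn_integral_cong split: split_indicator\<close>)

lemma hellinger_on_divide:
  fixes g0 g1 :: "'a::euclidean_space \<Rightarrow> real"
  assumes [measurable]: "g0 \<in> borel_measurable borel" "g1 \<in> borel_measurable borel" "C \<in> sets borel"
    and V: "V > 0"
  shows "hellinger_on C (\<lambda>y. g0 y / V) (\<lambda>y. g1 y / V) = hellinger_on C g0 g1 * ennreal (1 / V)"
proof -
  have "(sqrt (g0 y / V) - sqrt (g1 y / V))\<^sup>2 = (sqrt (g0 y) - sqrt (g1 y))\<^sup>2 * (1 / V)" for y
    using V by (simp add: real_sqrt_divide diff_divide_distrib[symmetric] power_divide)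
  then have "hellinger_on C (\<lambda>y. g0 y / V) (\<lambda>y. g1 y / V)
    = (\<integral>\<^sup>+ y. ennreal ((sqrt (g0 y) - sqrt (g1 y))\<^sup>2) * indicator C y * ennreal (1 / V) \<partial>lborel)"
    unfolding hellinger_on_def using V
    by (intro nn_integral_cong) (auto simp: ennreal_mult[symmetric] split: split_indicator)
  also have "\<dots> = hellinger_on C g0 g1 * ennreal (1 / V)"
    unfolding hellinger_on_def by (rule nn_integral_multc) measurable
  finally show ?thesis .
qed

lemma sum_hellinger_on_le:
  assumes J: "finite J" and [measurable]: "\<And>j. j \<in> J \<Longrightarrow> C j \<in> sets borel"
    "f \<in> borel_measurable borel" "g \<in> borel_measurable borel"
    and disj: "disjoint_family_on C J"
  shows "(\<Sum>j\<in>J. hellinger_on (C j) f g) \<le> hellinger_sq f g"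
proof -
  have "(\<Sum>j\<in>J. hellinger_on (C j) f g)
      = (\<integral>\<^sup>+ y. (\<Sum>j\<in>J. ennreal ((sqrt (f y) - sqrt (g y))\<^sup>2) * indicator (C j) y) \<partial>lborel)"
    unfolding hellinger_on_def by (rule nn_integral_sum[symmetric]) auto
  also have "\<dots> = (\<integral>\<^sup>+ y. ennreal ((sqrt (f y) - sqrt (g y))\<^sup>2) * indicator (\<Union>j\<in>J. C j) y \<partial>lborel)"
    by (intro nn_integral_cong) (simp add: sum_distrib_left[symmetric] indicator_UN_disjoint[OF J disj])
  also have "\<dots> \<le> hellinger_sq f g"
    unfolding hellinger_sq_def by (intro nn_integral_mono) (auto split: split_indicator)
  finally show ?thesis .
qed

section \<open>Subsets of the index set as vertices of a hypercube\<close>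

definition flip :: "'j \<Rightarrow> 'j set \<Rightarrow> 'j set" where
  "flip j S = (if j \<in> S then S - {j} else insert j S)"

lemma flip_flip [simp]: "flip j (flip j S) = S"
  by (auto simp: flip_def)

lemma mem_flip_same: "j \<in> flip j S \<longleftrightarrow> j \<notin> S"
  by (auto simp: flip_def)

lemma mem_flip_other: "i \<noteq> j \<Longrightarrow> i \<in> flip j S \<longleftrightarrow> i \<in> S"
  by (auto simp: flip_def)

lemma flip_Pow: "j \<in> J \<Longrightarrow> S \<in> Pow J \<Longrightarrow> flip j S \<in> Pow J"
  by (auto simp: flip_def)

lemma sum_flip:
  assumes "j \<in> J"
  shows "(\<Sum>S\<in>Pow J. h (flip j S)) = (\<Sum>S\<in>Pow J. h S)"
  by (rule sum.reindex_bij_witness[where i = "flip j" and j = "flip j"]) (use assms in \<open>auto simp: flip_def split: if_splits\<close>)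

text \<open>A vertex \<open>S\<close> picks in each pair \<open>A j True\<close>,
  \<open>A j False\<close> the one cell where \<open>p1\<close> replaces \<open>p0\<close>. As every
  pair contributes exactly one modified cell, the total mass can be the same at all
  vertices.\<close>

definition patched :: "('j \<Rightarrow> bool \<Rightarrow> 'a set) \<Rightarrow> 'j set \<Rightarrow> ('a \<Rightarrow> 'b) \<Rightarrow> ('a \<Rightarrow> 'b) \<Rightarrow> 'j set \<Rightarrow> 'a \<Rightarrow> 'b" where
  "patched A J p0 p1 S y = (if y \<in> (\<Union>j\<in>J. A j (j \<in> S)) then p1 y else p0 y)"

locale cells =
  fixes A :: "'j \<Rightarrow> bool \<Rightarrow> 'a::euclidean_space set" and J :: "'j set"
  assumes finite_J: "finite J"
    and sets_A [measurable]: "\<And>j c. A j c \<in> sets borel"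
    and disjoint_A: "\<And>j c j' c'. \<lbrakk>j \<in> J; j' \<in> J; (j, c) \<noteq> (j', c')\<rbrakk> \<Longrightarrow> A j c \<inter> A j' c' = {}"
begin

lemma mem_UN_cell_iff:
  assumes "j \<in> J" "y \<in> A j c"
  shows "y \<in> (\<Union>i\<in>J. A i (i \<in> S)) \<longleftrightarrow> c = (j \<in> S)"
proof -
  have *: "i = j \<and> d = c" if "i \<in> J" "y \<in> A i d" for i d
    using disjoint_A[OF that(1) assms(1), of d c] that(2) assms(2) by blast
  show ?thesis
  proof
    assume "y \<in> (\<Union>i\<in>J. A i (i \<in> S))"
    then obtain i where i: "i \<in> J" "y \<in> A i (i \<in> S)"
      by blast
    show "c = (j \<in> S)"
      using *[OF i] by blast
  next
    assume "c = (j \<in> S)"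
    with assms show "y \<in> (\<Union>i\<in>J. A i (i \<in> S))"
      by blast
  qed
qed

lemma patched_cell:
  assumes "j \<in> J" "y \<in> A j c"
  shows "patched A J p0 p1 S y = (if c = (j \<in> S) then p1 y else p0 y)"
  unfolding patched_def mem_UN_cell_iff[OF assms] ..

lemma patched_flip:
  assumes "y \<notin> A j True" "y \<notin> A j False"
  shows "patched A J p0 p1 (flip j S) y = patched A J p0 p1 S y"
proof -
  have "y \<in> A i (i \<in> flip j S) \<longleftrightarrow> y \<in> A i (i \<in> S)" for i
    using assms mem_flip_other[of i j S] by (cases "i = j"; cases "i \<in> S"; cases "i \<in> flip j S") auto
  then show ?thesis
    by (simp add: patched_def)
qed

lemma measurable_patched [measurable]:
  assumes [measurable]: "p0 \<in> borel_measurable borel" "p1 \<in> borel_measurable borel"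
  shows "patched A J p0 p1 S \<in> borel_measurable borel"
proof -
  have [measurable]: "(\<Union>j\<in>J. A j (j \<in> S)) \<in> sets borel"
    using finite_J by (intro sets.finite_UN) auto
  show ?thesis
    unfolding patched_def[abs_def] by measurable
qed

text \<open>On either cell of the pair \<open>j\<close>, one of the two adjacent vertices carries
  \<open>p0\<close> and the other \<open>p1\<close>.\<close>

lemma hellinger_on_patched_flip:
  assumes "j \<in> J"
  shows "hellinger_on (A j c) (patched A J p0 p1 S) (patched A J p0 p1 (flip j S)) = hellinger_on (A j c) p0 p1"
proof (cases "c = (j \<in> S)")
  case True
  then have "hellinger_on (A j c) (patched A J p0 p1 S) (patched A J p0 p1 (flip j S)) = hellinger_on (A j c) p1 p0"
    using assms by (intro hellinger_on_cong) (auto simp: patched_cell mem_flip_same)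
  then show ?thesis
    by (simp add: hellinger_on_commute)
next
  case False
  then show ?thesis
    using assms by (intro hellinger_on_cong) (auto simp: patched_cell mem_flip_same)
qed

text \<open>Adjacent vertices differ only on one pair, by at most \<open>2 * \<Gamma>\<close>, so
  the two-point bound forces the losses on that pair to add up to at least
  \<open>\<gamma> / 4\<close>. Local risks sum to at most the full risk; averaging over all vertices
  gives \<open>card J * \<gamma> / 8\<close>.\<close>

lemma assouad:
  fixes est :: "(nat \<Rightarrow> 'a) \<Rightarrow> 'a \<Rightarrow> real"
  assumes [measurable]: "p0 \<in> borel_measurable borel" "p1 \<in> borel_measurable borel"
    and lc: "\<And>S. S \<subseteq> J \<Longrightarrow> patched A J p0 p1 S \<in> log_concave_densities"
    and lower: "\<And>j c. j \<in> J \<Longrightarrow> ennreal \<gamma> \<le> hellinger_on (A j c) p0 p1"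
    and upper: "\<And>j c. j \<in> J \<Longrightarrow> hellinger_on (A j c) p0 p1 \<le> ennreal \<Gamma>"
    and \<Gamma>: "0 \<le> \<Gamma>" "real n * \<Gamma> \<le> 1 / 4" and \<gamma>: "0 \<le> \<gamma>"
    and est: "est \<in> estimators n"
  shows "ennreal (real (card J) * \<gamma> / 8) \<le> (SUP f\<in>log_concave_densities. hellinger_risk n est f)"
proof -
  let ?X = "Pi\<^sub>M {..<n} (\<lambda>_. borel :: 'a measure)"
  define f where "f = patched A J p0 p1"
  have f_lc: "f S \<in> log_concave_densities" if "S \<in> Pow J" for S
    using lc that by (auto simp: f_def)
  then have f_dens: "f S \<in> densities" if "S \<in> Pow J" for S
    using that by (auto simp: log_concave_densities_def)
  have [measurable]: "f S \<in> borel_measurable borel" for S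
    unfolding f_def by measurable
  define C where "C j = A j True \<union> A j False" for j
  have [measurable]: "C j \<in> sets borel" for j
    unfolding C_def by measurable
  have disj_C: "disjoint_family_on C J"
  proof (unfold disjoint_family_on_def, intro ballI impI)
    fix i j assume "i \<in> J" "j \<in> J" "i \<noteq> j"
    then have "A i c \<inter> A j c' = {}" for c c'
      using disjoint_A by simp
    then show "C i \<inter> C j = {}"
      by (simp add: C_def Int_Un_distrib Int_Un_distrib2)
  qed
  have disj_j: "A j True \<inter> A j False = {}" if "j \<in> J" for j
    using disjoint_A[OF that that, of True False] by simp
  define u where "u S j x = hellinger_on (C j) (est x) (f S)" for S j x
  define R where "R S j = (\<integral>\<^sup>+ x. u S j x \<partial>sample_law n (f S))" for S j
  have est_dens: "est x \<in> densities" if "x \<in> space ?X" for x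
    using measurable_space[OF est[unfolded estimators_def] that] by (simp add: space_restrict_space)
  have u_meas[measurable]: "u S j \<in> borel_measurable ?X" for S j
    using measurable_comp[OF est[unfolded estimators_def] measurable_hellinger_on[of "C j" "f S"]]
    by (simp add: u_def[abs_def] comp_def)
  have sets_law[measurable_cong]: "sets (sample_law n (f S)) = sets ?X" for S
    unfolding sample_law_def by (simp cong: sets_PiM_cong)
  have sp_law: "space (sample_law n (f S)) = space ?X" for S
    by (rule sets_eq_imp_space_eq[OF sets_law])
  have hell_C: "hellinger_on (C j) (f S) (f (flip j S)) = hellinger_on (A j True) p0 p1 + hellinger_on (A j False) p0 p1"
    if "j \<in> J" for j S
    unfolding C_def using disj_j[OF that]
    by (subst hellinger_on_union) (auto simp: f_def hellinger_on_patched_flip[OF that])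
  have pair: "ennreal \<gamma> / 4 \<le> R S j + R (flip j S) j" if j: "j \<in> J" and S: "S \<in> Pow J" for S j
    unfolding R_def
  proof (rule two_point_bound[OF f_dens[OF S] f_dens[OF flip_Pow[OF j S]] \<Gamma>])
    have "hellinger_sq (f S) (f (flip j S)) = hellinger_on (C j) (f S) (f (flip j S))"
      unfolding hellinger_sq_def hellinger_on_def
      by (intro nn_integral_cong) (auto simp: C_def f_def patched_flip split: split_indicator)
    also have "\<dots> \<le> ennreal \<Gamma> + ennreal \<Gamma>"
      unfolding hell_C[OF j] by (intro add_mono upper j)
    also have "\<dots> = ennreal (2 * \<Gamma>)"
      using \<Gamma> by (simp add: ennreal_plus[symmetric] del: ennreal_plus)
    finally show "hellinger_sq (f S) (f (flip j S)) \<le> ennreal (2 * \<Gamma>)" .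
    fix x assume x: "x \<in> space ?X"
    \<comment> \<open>Both cells of the pair contribute \<open>\<gamma>\<close>, and this factor 2
      cancels the one in the triangle inequality for squares.\<close>
    have "2 * ennreal \<gamma> \<le> hellinger_on (C j) (f S) (f (flip j S))"
      unfolding hell_C[OF j] mult_2 by (intro add_mono lower j)
    also have "\<dots> \<le> 2 * (u S j x + u (flip j S) j x)"
      unfolding u_def using densitiesD(1)[OF est_dens[OF x]] by (intro hellinger_on_triangle) auto
    finally show "ennreal \<gamma> \<le> u S j x + u (flip j S) j x"
      by (subst (asm) ennreal_mult_le_mult_iff) auto
  qed (rule u_meas)+
  have risk: "(\<Sum>j\<in>J. R S j) \<le> hellinger_risk n est (f S)" if S: "S \<in> Pow J" for S
  proof -
    have "(\<Sum>j\<in>J. R S j) = (\<integral>\<^sup>+ x. (\<Sum>j\<in>J. u S j x) \<partial>sample_law n (f S))"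
      unfolding R_def by (rule nn_integral_sum[symmetric]) measurable
    also have "\<dots> \<le> hellinger_risk n est (f S)"
      unfolding hellinger_risk_def u_def sp_law
    proof (rule nn_integral_mono)
      fix x assume "x \<in> space (sample_law n (f S))"
      then show "(\<Sum>j\<in>J. hellinger_on (C j) (est x) (f S)) \<le> hellinger_sq (est x) (f S)"
        using densitiesD(1)[OF est_dens] unfolding sp_law
        by (intro sum_hellinger_on_le finite_J disj_C) auto
    qed
    finally show ?thesis .
  qed
  let ?s = "SUP f\<in>log_concave_densities. hellinger_risk n est f"
  have "of_nat (card (Pow J)) * (of_nat (card J) * (ennreal \<gamma> / 4)) = (\<Sum>j\<in>J. \<Sum>S\<in>Pow J. ennreal \<gamma> / 4)"
    by (simp add: mult_ac)
  also have "\<dots> \<le> (\<Sum>j\<in>J. \<Sum>S\<in>Pow J. R S j + R (flip j S) j)"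
    by (intro sum_mono pair)
  \<comment> \<open>\<open>flip j\<close> permutes the vertices, so each local risk is counted
    twice.\<close>
  also have "\<dots> = (\<Sum>j\<in>J. 2 * (\<Sum>S\<in>Pow J. R S j))"
    by (intro sum.cong refl) (simp add: sum.distrib sum_flip[where h = "\<lambda>S. R S _"] mult_2)
  also have "\<dots> = 2 * (\<Sum>S\<in>Pow J. \<Sum>j\<in>J. R S j)"
    by (subst sum.swap) (simp add: sum_distrib_left)
  also have "\<dots> \<le> 2 * (\<Sum>S\<in>Pow J. ?s)"
    by (intro mult_left_mono sum_mono order_trans[OF risk] SUP_upper f_lc) auto
  also have "\<dots> = of_nat (card (Pow J)) * (2 * ?s)"
    by (simp add: mult_ac)
  finally have "of_nat (card J) * (ennreal \<gamma> / 4) \<le> 2 * ?s"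
    using finite_J ennreal_of_nat_neq_top[of "card (Pow J)"]
    by (subst (asm) ennreal_mult_le_mult_iff) (simp_all add: card_Pow del: of_nat_power)
  moreover have "of_nat (card J) * (ennreal \<gamma> / 4) = 2 * ennreal (real (card J) * \<gamma> / 8)"
  proof -
    have "of_nat (card J) * (ennreal \<gamma> / 4) = ennreal (real (card J) * (\<gamma> / 4))"
      unfolding ennreal_divide_numeral[OF \<gamma>] ennreal_of_nat_eq_real_of_nat
      using \<gamma> by (intro ennreal_mult[symmetric]) auto
    also have "real (card J) * (\<gamma> / 4) = 2 * (real (card J) * \<gamma> / 8)"
      by simp
    also have "ennreal \<dots> = 2 * ennreal (real (card J) * \<gamma> / 8)"
      using \<gamma> by (subst ennreal_mult) auto
    finally show ?thesis .
  qed
  ultimately have "2 * ennreal (real (card J) * \<gamma> / 8) \<le> 2 * ?s"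
    by simp
  then show ?thesis
    by (subst (asm) ennreal_mult_le_mult_iff) auto
qed


text \<open>Each pair loses the mass \<open>v\<close> on exactly one of its cells, whichever it is.
  The identity is additive because subtraction in \<open>ennreal\<close> is truncated.\<close>

lemma mass_patched:
  fixes g0 g1 :: "'a \<Rightarrow> real"
  assumes [measurable]: "g0 \<in> borel_measurable borel" "g1 \<in> borel_measurable borel"
    and le: "\<And>y. 0 \<le> g1 y" "\<And>y. g1 y \<le> g0 y"
    and v: "\<And>j c. j \<in> J \<Longrightarrow> (\<integral>\<^sup>+ y\<in>A j c. ennreal (g0 y - g1 y) \<partial>lborel) = v"
  shows "(\<integral>\<^sup>+ y. ennreal (patched A J g0 g1 S y) \<partial>lborel) + of_nat (card J) * v = (\<integral>\<^sup>+ y. ennreal (g0 y) \<partial>lborel)"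
proof -
  have disj: "disjoint_family_on (\<lambda>j. A j (j \<in> S)) J"
    unfolding disjoint_family_on_def using disjoint_A by simp
  have "of_nat (card J) * v = (\<Sum>j\<in>J. \<integral>\<^sup>+ y\<in>A j (j \<in> S). ennreal (g0 y - g1 y) \<partial>lborel)"
    by (simp add: v)
  also have "\<dots> = (\<integral>\<^sup>+ y. (\<Sum>j\<in>J. ennreal (g0 y - g1 y) * indicator (A j (j \<in> S)) y) \<partial>lborel)"
    by (rule nn_integral_sum[symmetric]) measurable
  also have "\<dots> = (\<integral>\<^sup>+ y. ennreal (g0 y - g1 y) * indicator (\<Union>j\<in>J. A j (j \<in> S)) y \<partial>lborel)"
    by (intro nn_integral_cong) (simp add: sum_distrib_left[symmetric] indicator_UN_disjoint[OF finite_J disj])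
  finally have *: "of_nat (card J) * v = \<dots>" .
  have [measurable]: "(\<Union>j\<in>J. A j (j \<in> S)) \<in> sets borel"
    using finite_J by (intro sets.finite_UN) auto
  have "(\<integral>\<^sup>+ y. ennreal (patched A J g0 g1 S y) \<partial>lborel) + of_nat (card J) * v
      = (\<integral>\<^sup>+ y. ennreal (patched A J g0 g1 S y)
        + ennreal (g0 y - g1 y) * indicator (\<Union>j\<in>J. A j (j \<in> S)) y \<partial>lborel)"
    unfolding * by (rule nn_integral_add[symmetric]) measurable
  also have "\<dots> = (\<integral>\<^sup>+ y. ennreal (g0 y) \<partial>lborel)"
  proof (rule nn_integral_cong)
    fix y
    have "ennreal (g1 y) + ennreal (g0 y - g1 y) = ennreal (g0 y)"
      using le[of y] by (subst ennreal_plus[symmetric]) auto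
    moreover define U where "U = (\<Union>j\<in>J. A j (j \<in> S))"
    ultimately show "ennreal (patched A J g0 g1 S y)
        + ennreal (g0 y - g1 y) * indicator (\<Union>j\<in>J. A j (j \<in> S)) y = ennreal (g0 y)"
      unfolding patched_def U_def[symmetric] by (cases "y \<in> U") simp_all
  qed
  finally show ?thesis .
qed

text \<open>Equal cell masses give all vertices one normalising constant \<open>V\<close>, so
  normalising commutes with patching. Squared Hellinger distances are divided by \<open>V\<close>:
  as \<open>1 \<le> V\<close> the upper bound survives, and as \<open>V \<le> W\<close> the lower
  bound becomes \<open>\<gamma> / W\<close>. \<open>K S\<close> and \<open>h S\<close> are the
  support and the positive concave values at the vertex \<open>S\<close>.\<close>

lemma assouad_unnormalized:
  fixes g0 g1 :: "'a \<Rightarrow> real" and est :: "(nat \<Rightarrow> 'a) \<Rightarrow> 'a \<Rightarrow> real"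
  assumes meas[measurable]: "g0 \<in> borel_measurable borel" "g1 \<in> borel_measurable borel"
    and le: "\<And>y. 0 \<le> g1 y" "\<And>y. g1 y \<le> g0 y"
    and v: "\<And>j c. j \<in> J \<Longrightarrow> (\<integral>\<^sup>+ y\<in>A j c. ennreal (g0 y - g1 y) \<partial>lborel) = v" "v < \<infinity>"
    and mass: "\<And>S. S \<subseteq> J \<Longrightarrow> 1 \<le> (\<integral>\<^sup>+ y. ennreal (patched A J g0 g1 S y) \<partial>lborel)"
      "\<And>S. S \<subseteq> J \<Longrightarrow> (\<integral>\<^sup>+ y. ennreal (patched A J g0 g1 S y) \<partial>lborel) \<le> ennreal W"
    and shape: "\<And>S. S \<subseteq> J \<Longrightarrow> closed (K S)" "\<And>S. S \<subseteq> J \<Longrightarrow> convex (K S)"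
      "\<And>S. S \<subseteq> J \<Longrightarrow> continuous_on (K S) (h S)" "\<And>S. S \<subseteq> J \<Longrightarrow> concave_on (K S) (h S)"
      "\<And>S y. S \<subseteq> J \<Longrightarrow> y \<in> K S \<Longrightarrow> h S y > 0"
      "\<And>S y. S \<subseteq> J \<Longrightarrow> patched A J g0 g1 S y = (if y \<in> K S then h S y else 0)"
    and lower: "\<And>j c. j \<in> J \<Longrightarrow> ennreal \<gamma> \<le> hellinger_on (A j c) g0 g1"
    and upper: "\<And>j c. j \<in> J \<Longrightarrow> hellinger_on (A j c) g0 g1 \<le> ennreal \<Gamma>"
    and \<Gamma>: "0 \<le> \<Gamma>" "real n * \<Gamma> \<le> 1 / 4" and \<gamma>: "0 \<le> \<gamma>"
    and est: "est \<in> estimators n"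
  shows "ennreal (real (card J) * (\<gamma> / W) / 8) \<le> (SUP f\<in>log_concave_densities. hellinger_risk n est f)"
proof -
  let ?m = "\<lambda>S. \<integral>\<^sup>+ y. ennreal (patched A J g0 g1 S y) \<partial>lborel"
  have m_eq: "?m S = ?m {}" for S
  proof -
    \<comment> \<open>The mass removed is the same at every vertex and finite, so it can be
      cancelled.\<close>
    have "?m S + of_nat (card J) * v = ?m {} + of_nat (card J) * v"
      using mass_patched[OF meas le v(1)] by simp
    moreover have "of_nat (card J) * v \<noteq> \<infinity>"
      using v(2) by (simp add: ennreal_mult_eq_top_iff)
    ultimately show ?thesis
      by (simp add: ennreal_add_left_cancel add.commute)
  qed
  obtain V where V: "?m {} = ennreal V" "V \<ge> 0"
    using mass(2)[OF empty_subsetI] by (cases "?m {}") (simp_all add: top_unique)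
  have V1: "V \<ge> 1"
    using mass(1)[OF empty_subsetI] V by simp
  have "ennreal V \<le> ennreal W"
    using mass(2)[OF empty_subsetI] V by simp
  then have VW: "V \<le> W"
    using V1 by (auto simp: ennreal_le_iff2)
  define p0 where "p0 y = g0 y / V" for y
  define p1 where "p1 y = g1 y / V" for y
  have [measurable]: "p0 \<in> borel_measurable borel" "p1 \<in> borel_measurable borel"
    unfolding p0_def[abs_def] p1_def[abs_def] by measurable
  have p_eq: "patched A J p0 p1 S y = patched A J g0 g1 S y / V" for S y
    by (simp add: patched_def p0_def p1_def)
  have nonneg: "patched A J g0 g1 S y \<ge> 0" for S y
    using le[of y] by (auto simp: patched_def)
  have dens: "patched A J p0 p1 S \<in> densities" for S
  proof -
    have "(\<integral>\<^sup>+ y. ennreal (patched A J p0 p1 S y) \<partial>lborel)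
        = (\<integral>\<^sup>+ y. ennreal (patched A J g0 g1 S y) * ennreal (1 / V) \<partial>lborel)"
      unfolding p_eq using nonneg[of S] V1
      by (intro nn_integral_cong) (simp add: ennreal_mult[symmetric])
    also have "\<dots> = ?m S * ennreal (1 / V)"
      by (rule nn_integral_multc) measurable
    also have "\<dots> = 1"
      unfolding m_eq[of S] V(1) using V1 by (simp add: ennreal_mult[symmetric])
    finally have "(\<integral>\<^sup>+ y. ennreal (patched A J p0 p1 S y) \<partial>lborel) = 1" .
    moreover have "0 \<le> patched A J p0 p1 S y" for y
      using nonneg[of S y] V1 by (simp add: p_eq)
    moreover have "patched A J p0 p1 S \<in> borel_measurable borel"
      by measurable
    ultimately show ?thesis
      unfolding densities_def by blast
  qed
  have hell: "hellinger_on (A j c) p0 p1 = hellinger_on (A j c) g0 g1 * ennreal (1 / V)" for j c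
    unfolding p0_def[abs_def] p1_def[abs_def] using V1 by (intro hellinger_on_divide) auto
  show ?thesis
  proof (rule assouad[where ?p0.0 = p0 and ?p1.0 = p1 and \<gamma> = "\<gamma> / W" and \<Gamma> = \<Gamma>])
    fix S assume S: "S \<subseteq> J"
    show "patched A J p0 p1 S \<in> log_concave_densities"
    proof (rule log_concave_density_intro[OF dens shape(1,2)[OF S], where g = "\<lambda>y. h S y / V"])
      show "continuous_on (K S) (\<lambda>y. h S y / V)"
        using V1 by (intro continuous_on_divide continuous_on_const shape(3)[OF S]) auto
      show "concave_on (K S) (\<lambda>y. h S y / V)"
        using V1 by (intro concave_on_cdiv shape(4)[OF S]) auto
      show "h S y / V > 0" if "y \<in> K S" for y
        using V1 shape(5)[OF S that] by simp
    qed (simp add: p_eq shape(6)[OF S])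
  next
    fix j c assume j: "j \<in> J"
    have "ennreal (\<gamma> / W) \<le> ennreal (\<gamma> * (1 / V))"
      using V1 VW \<gamma> by (intro ennreal_leI) (auto intro!: divide_left_mono)
    also have "\<dots> = ennreal \<gamma> * ennreal (1 / V)"
      using V1 \<gamma> by (intro ennreal_mult) auto
    also have "\<dots> \<le> hellinger_on (A j c) p0 p1"
      unfolding hell by (intro mult_right_mono lower j) auto
    finally show "ennreal (\<gamma> / W) \<le> hellinger_on (A j c) p0 p1" .
    have "hellinger_on (A j c) p0 p1 \<le> ennreal \<Gamma> * ennreal (1 / V)"
      unfolding hell by (intro mult_right_mono upper j) auto
    also have "\<dots> \<le> ennreal \<Gamma> * 1"
      using V1 by (intro mult_left_mono) (auto simp flip: ennreal_1 intro!: ennreal_leI)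
    also have "\<dots> = ennreal \<Gamma>"
      by simp
    finally show "hellinger_on (A j c) p0 p1 \<le> ennreal \<Gamma>" .
  qed (use \<Gamma> \<gamma> V1 VW est in auto)
qed

end

text \<open>With \<open>N\<close> cells per axis there are \<open>N ^ k\<close> pairs, each of
  squared Hellinger size of order \<open>1 / N ^ a\<close>. Taking \<open>N\<close> of order
  \<open>n powr (1 / a)\<close> makes a flip undetectable and leaves a bound of order
  \<open>1 / N ^ (a - k)\<close>.\<close>

lemma minimax_rate:
  fixes a k :: nat and K1 K2 :: real
  assumes "K1 > 0" "K2 > 0" "k < a"
    and key: "\<And>N n (est :: (nat \<Rightarrow> 'a::euclidean_space) \<Rightarrow> 'a \<Rightarrow> real).
      \<lbrakk>1 \<le> N; est \<in> estimators n; real n * (K1 / real N ^ a) \<le> 1 / 4\<rbrakk> \<Longrightarrow>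
      ennreal (real N ^ k * (K2 / real N ^ a)) \<le> (SUP f\<in>log_concave_densities. hellinger_risk n est f)"
  shows "\<exists>c>0. \<forall>n\<ge>1. ennreal (c * real n powr (- (real a - real k) / real a))
      \<le> (INF est\<in>estimators n. SUP f\<in>(log_concave_densities :: ('a \<Rightarrow> real) set). hellinger_risk n est f)"
proof -
  \<comment> \<open>\<open>4 * K1 \<le> C\<close> secures the condition on \<open>n\<close> in
    \<open>key\<close>; \<open>C \<ge> 1\<close> gives \<open>C \<le> C ^ a\<close> and
    \<open>N \<ge> 1\<close>.\<close>
  define C where "C = 1 + 4 * K1"
  have C: "C \<ge> 1" "4 * K1 \<le> C"
    using assms by (auto simp: C_def)
  \<comment> \<open>The factor \<open>2 * C\<close> is the price of rounding: \<open>N\<close> is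
    \<open>C * r\<close> rounded up, and \<open>C * r \<ge> 1\<close> gives
    \<open>N \<le> 2 * C * r\<close>.\<close>
  define c where "c = K2 / (2 * C) ^ (a - k)"
  have "c > 0"
    using assms C by (simp add: c_def)
  moreover have "ennreal (c * real n powr (- (real a - real k) / real a))
      \<le> (INF est\<in>estimators n. SUP f\<in>(log_concave_densities :: ('a \<Rightarrow> real) set). hellinger_risk n est f)"
    if n: "n \<ge> 1" for n
  proof (rule INF_greatest)
    fix est :: "(nat \<Rightarrow> 'a) \<Rightarrow> 'a \<Rightarrow> real"
    assume est: "est \<in> estimators n"
    define r where "r = real n powr (1 / real a)"
    have r: "r \<ge> 1" "r ^ a = real n"
      using n assms by (auto simp: r_def ge_one_powr_ge_zero powr_realpow[symmetric] powr_powr)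
    define N where "N = nat \<lceil>C * r\<rceil>"
    have Cr: "C * r \<ge> 1"
      using C r mult_mono[of 1 C 1 r] by simp
    have N: "C * r \<le> real N" "real N \<le> 2 * C * r" "N \<ge> 1"
      using Cr unfolding N_def by linarith+
    have "4 * K1 * real n \<le> C * r ^ a"
      using C r by (simp add: mult_right_mono)
    also have "\<dots> \<le> C ^ a * r ^ a"
      using C r assms by (intro mult_right_mono self_le_power) auto
    also have "\<dots> = (C * r) ^ a"
      by (simp add: power_mult_distrib)
    also have "\<dots> \<le> real N ^ a"
      using N Cr by (intro power_mono) auto
    finally have "real n * (K1 / real N ^ a) \<le> 1 / 4"
      using N by (simp add: field_simps)
    from key[OF N(3) est this]
    have *: "ennreal (real N ^ k * (K2 / real N ^ a)) \<le> (SUP f\<in>log_concave_densities. hellinger_risk n est f)" .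
    have "r ^ (a - k) = real n powr ((real a - real k) / real a)"
      using n assms by (simp add: r_def powr_realpow[symmetric] powr_powr of_nat_diff)
    then have "c * real n powr (- (real a - real k) / real a) = c / r ^ (a - k)"
      unfolding minus_divide_left[symmetric] powr_minus by (simp add: divide_inverse)
    also have "\<dots> = K2 / (2 * C * r) ^ (a - k)"
      by (simp add: c_def power_mult_distrib)
    also have "\<dots> \<le> K2 / real N ^ (a - k)"
      using N C r assms(1-3) by (intro divide_left_mono power_mono mult_pos_pos zero_less_power) auto
    also have "\<dots> = real N ^ k * (K2 / real N ^ a)"
    proof -
      have "real N ^ a = real N ^ k * real N ^ (a - k)"
        using assms by (simp add: power_add[symmetric])
      then show ?thesis
        using N by simp
    qed
    finally show "ennreal (c * real n powr (- (real a - real k) / real a))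
      \<le> (SUP f\<in>log_concave_densities. hellinger_risk n est f)"
      using * by (meson ennreal_leI order_trans)
  qed
  ultimately show ?thesis
    by blast
qed

section \<open>Cells and truncated paraboloids\<close>

lemma box_coords:
  fixes l u :: "'a::euclidean_space \<Rightarrow> real"
  shows "{y. \<forall>b\<in>Basis. l b \<le> y \<bullet> b \<and> y \<bullet> b \<le> u b} = cbox (\<Sum>b\<in>Basis. l b *\<^sub>R b) (\<Sum>b\<in>Basis. u b *\<^sub>R b)"
  by (auto simp: mem_box inner_sum_left_Basis)

lemma emeasure_box_coords:
  fixes l u :: "'a::euclidean_space \<Rightarrow> real"
  assumes "\<And>b. b \<in> Basis \<Longrightarrow> l b \<le> u b"
  shows "emeasure lborel {y. \<forall>b\<in>Basis. l b \<le> y \<bullet> b \<and> y \<bullet> b \<le> u b} = ennreal (\<Prod>b\<in>Basis. u b - l b)"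
  unfolding box_coords using assms by (subst emeasure_lborel_cbox) (auto simp: inner_sum_left_Basis inner_diff_left)

lemma nn_integral_lborel_translate:
  fixes F :: "'a::euclidean_space \<Rightarrow> ennreal"
  assumes [measurable]: "F \<in> borel_measurable borel"
  shows "(\<integral>\<^sup>+ y. F (a + y) \<partial>lborel) = (\<integral>\<^sup>+ y. F y \<partial>lborel)"
  by (subst (2) lborel_distr_plus[symmetric, of a]) (simp add: nn_integral_distr)

text \<open>\<open>B\<close> holds the directions in which the paraboloid is curved: all of
  \<open>Basis\<close> for the marginal densities, all but the vertical one for uniform densities on
  bodies.\<close>

locale grid =
  fixes B :: "'a::euclidean_space set" and N :: nat
  assumes B_sub: "B \<subseteq> Basis" and B_ne: "B \<noteq> {}" and N_pos: "1 \<le> N"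
begin

text \<open>Half the mesh \<open>1 / N\<close> of the unit cube: balls of this radius fit into the
  mesh cubes.\<close>

definition eps :: real where "eps = 1 / (2 * real N)"

text \<open>The extensional function space counts every multi-index on \<open>B\<close>
  once.\<close>

definition index :: "('a \<Rightarrow> nat) set" where "index = B \<rightarrow>\<^sub>E {..<N}"

text \<open>The two members of a pair are the midpoint of a mesh cube in \<open>[0,1]^B\<close> and
  its translate by 1 in every direction of \<open>B\<close>, which lies in
  \<open>[1,2]^B\<close>.\<close>

definition centre :: "('a \<Rightarrow> nat) \<Rightarrow> bool \<Rightarrow> 'a \<Rightarrow> real" where
  "centre k c b = (2 * real (k b) + 1) * eps + (if c then 1 else 0)"

definition sqdist :: "'a \<Rightarrow> ('a \<Rightarrow> real) \<Rightarrow> real" where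
  "sqdist y z = (\<Sum>b\<in>B. (y \<bullet> b - z b)\<^sup>2)"

definition quad :: "'a \<Rightarrow> real" where
  "quad y = (\<Sum>b\<in>B. (y \<bullet> b)\<^sup>2)"

definition cell :: "('a \<Rightarrow> nat) \<Rightarrow> bool \<Rightarrow> 'a set" where
  "cell k c = {y. sqdist y (centre k c) < eps\<^sup>2}"

text \<open>\<open>quad y - sqdist y z\<close> is affine in \<open>y\<close>: the tangent hyperplane
  to the paraboloid at \<open>z\<close>. So \<open>quad y + cap y z\<close> is the maximum of the
  paraboloid and this hyperplane raised by \<open>eps\<^sup>2\<close>; the two meet where
  \<open>sqdist y z = eps\<^sup>2\<close>.\<close>

definition cap :: "'a \<Rightarrow> ('a \<Rightarrow> real) \<Rightarrow> real" where
  "cap y z = max 0 (eps\<^sup>2 - sqdist y z)"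

definition cut :: "('a \<Rightarrow> nat) set \<Rightarrow> 'a \<Rightarrow> real" where
  "cut S y = quad y + (\<Sum>k\<in>index. cap y (centre k (k \<in> S)))"

text \<open>Both caps of each pair are cut; \<open>patched\<close> takes the modified values from
  here, on one cell per pair.\<close>

definition cut_all :: "'a \<Rightarrow> real" where
  "cut_all y = quad y + (\<Sum>k\<in>index. cap y (centre k True) + cap y (centre k False))"

definition dom :: "'a set" where
  "dom = {y. \<forall>b\<in>B. 0 \<le> y \<bullet> b \<and> y \<bullet> b \<le> 2}"

section \<open>Regularity and geometry of the grid\<close>

lemma finite_B: "finite B"
  using B_sub by (rule finite_subset) simp

lemma card_B_pos: "card B \<ge> 1"
  using finite_B B_ne by (simp add: Suc_le_eq card_gt_0_iff)

lemma eps_pos: "eps > 0"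
  using N_pos by (simp add: eps_def)

lemma eps_le: "eps \<le> 1 / 2" "eps\<^sup>2 \<le> 1 / 4"
proof -
  show "eps \<le> 1 / 2"
    using N_pos by (simp add: eps_def field_simps)
  then show "eps\<^sup>2 \<le> 1 / 4"
    using eps_pos power_mono[of eps "1 / 2" 2] by (simp add: power_divide)
qed

lemma finite_index: "finite index"
  unfolding index_def using finite_B by (intro finite_PiE) auto

lemma card_index: "card index = N ^ card B"
  unfolding index_def using finite_B by (simp add: card_PiE)

lemma continuous_sqdist [continuous_intros]: "continuous_on X (\<lambda>y. sqdist y z)"
  unfolding sqdist_def by (intro continuous_intros)

lemma continuous_quad [continuous_intros]: "continuous_on X quad"
  unfolding quad_def[abs_def] by (intro continuous_intros)

lemma continuous_cap [continuous_intros]: "continuous_on X (\<lambda>y. cap y z)"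
  unfolding cap_def by (intro continuous_intros)

lemma continuous_cut [continuous_intros]: "continuous_on X (cut S)"
  unfolding cut_def[abs_def] by (intro continuous_intros)

lemma continuous_cut_all: "continuous_on X cut_all"
  unfolding cut_all_def[abs_def] by (intro continuous_intros)

lemma measurable_grid [measurable]:
  "(\<lambda>y. sqdist y z) \<in> borel_measurable borel" "quad \<in> borel_measurable borel"
  "(\<lambda>y. cap y z) \<in> borel_measurable borel" "cut S \<in> borel_measurable borel"
  "cut_all \<in> borel_measurable borel"
  by (intro borel_measurable_continuous_onI continuous_intros continuous_cut_all)+

lemma cell_borel [measurable]: "cell k c \<in> sets borel"
  unfolding cell_def by measurable

lemma closed_dom: "closed dom"
proof -
  have "dom = (\<Inter>b\<in>B. {y. 0 \<le> y \<bullet> b} \<inter> {y. y \<bullet> b \<le> 2})"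
    by (auto simp: dom_def)
  then show ?thesis
    by (auto intro!: closed_INT closed_Int closed_Collect_le continuous_intros)
qed

lemma dom_borel [measurable]: "dom \<in> sets borel"
  using closed_dom by (rule borel_closed)

lemma convex_dom: "convex dom"
proof -
  have "dom = (\<Inter>b\<in>B. {y. b \<bullet> y \<ge> 0} \<inter> {y. b \<bullet> y \<le> 2})"
    by (auto simp: dom_def inner_commute)
  then show ?thesis
    by (auto intro!: convex_INT convex_Int convex_halfspace_le convex_halfspace_ge)
qed

lemma sqdist_coord:
  assumes "sqdist y z < eps\<^sup>2" "b \<in> B"
  shows "\<bar>y \<bullet> b - z b\<bar> < eps"
proof -
  have "(y \<bullet> b - z b)\<^sup>2 \<le> sqdist y z"
    unfolding sqdist_def using assms finite_B by (intro member_le_sum) auto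
  with assms(1) have "\<bar>y \<bullet> b - z b\<bar>\<^sup>2 < eps\<^sup>2"
    by simp
  from power2_less_imp_less[OF this] show ?thesis
    using eps_pos by simp
qed

text \<open>A cube of half-side \<open>eps / (2 * card B)\<close> fits into the ball of radius
  \<open>eps / 2\<close>. There a cap keeps at least 3/4 of its maximal height, which feeds the
  lower bounds on cells.\<close>

lemma sqdist_le_box:
  assumes "\<And>b. b \<in> B \<Longrightarrow> \<bar>y \<bullet> b - z b\<bar> \<le> eps / (2 * real (card B))"
  shows "sqdist y z \<le> eps\<^sup>2 / 4"
proof -
  have "sqdist y z \<le> (\<Sum>b\<in>B. (eps / (2 * real (card B)))\<^sup>2)"
    unfolding sqdist_def
  proof (rule sum_mono)
    fix b assume "b \<in> B"
    then have "\<bar>y \<bullet> b - z b\<bar>\<^sup>2 \<le> (eps / (2 * real (card B)))\<^sup>2"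
      using assms by (intro power_mono) auto
    then show "(y \<bullet> b - z b)\<^sup>2 \<le> (eps / (2 * real (card B)))\<^sup>2"
      by simp
  qed
  also have "\<dots> = eps\<^sup>2 / (4 * real (card B))"
    using card_B_pos by (simp add: power2_eq_square field_simps)
  also have "\<dots> \<le> eps\<^sup>2 / 4"
    using card_B_pos by (intro divide_left_mono) auto
  finally show ?thesis .
qed

lemma centre_bounds:
  assumes "k \<in> index" "b \<in> B"
  shows "eps \<le> centre k False b" "centre k False b \<le> 1 - eps" "centre k True b = centre k False b + 1"
proof -
  have "k b < N"
    using assms by (auto simp: index_def)
  then have "2 * real (k b) + 1 \<le> 2 * real N - 1"
    by linarith
  then have "(2 * real (k b) + 1) * eps \<le> (2 * real N - 1) * eps"
    using eps_pos by (intro mult_right_mono) auto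
  also have "\<dots> = 1 - eps"
    using N_pos by (simp add: eps_def field_simps)
  finally show "centre k False b \<le> 1 - eps"
    by (simp add: centre_def)
  show "eps \<le> centre k False b" "centre k True b = centre k False b + 1"
    using eps_pos by (auto simp: centre_def distrib_right)
qed

lemma cell_subset_dom:
  assumes "k \<in> index"
  shows "cell k c \<subseteq> dom"
proof
  fix y assume y: "y \<in> cell k c"
  have "0 \<le> y \<bullet> b \<and> y \<bullet> b \<le> 2" if b: "b \<in> B" for b
    using sqdist_coord[of y "centre k c" b] y b centre_bounds[OF assms b] unfolding cell_def
    by (cases c) auto
  then show "y \<in> dom"
    by (simp add: dom_def)
qed

text \<open>Centres of opposite type lie on opposite sides of 1, each at least \<open>eps\<close>
  away from it. Centres of the same type with distinct multi-indices differ by at least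
  \<open>2 * eps\<close> in some coordinate.\<close>

lemma cells_disjoint:
  assumes "k \<in> index" "k' \<in> index" "y \<in> cell k c" "y \<in> cell k' c'"
  shows "k = k' \<and> c = c'"
proof -
  have near: "\<bar>centre k c b - centre k' c' b\<bar> < 2 * eps" if "b \<in> B" for b
    using sqdist_coord[of y "centre k c" b] sqdist_coord[of y "centre k' c'" b] assms(3,4) that
    unfolding cell_def by auto
  obtain b0 where b0: "b0 \<in> B"
    using B_ne by auto
  have c: "c = c'"
    using near[OF b0] centre_bounds[OF assms(1) b0] centre_bounds[OF assms(2) b0]
    by (cases c; cases c') auto
  have "k b = k' b" if b: "b \<in> B" for b
  proof -
    have "\<bar>2 * (real (k b) - real (k' b)) * eps\<bar> < 2 * eps"
      using near[OF b] c by (simp add: centre_def algebra_simps)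
    then have "\<bar>real (k b) - real (k' b)\<bar> < 1"
      using eps_pos by (simp add: abs_mult)
    then show ?thesis by linarith
  qed
  then have "k = k'"
    using assms(1,2) unfolding index_def by (intro PiE_ext) auto
  with c show ?thesis by simp
qed

sublocale cells cell index
proof
  fix k k' :: "'a \<Rightarrow> nat" and c c' :: bool assume "k \<in> index" "k' \<in> index" "(k, c) \<noteq> (k', c')"
  then show "cell k c \<inter> cell k' c' = {}"
    using cells_disjoint[of k k' _ c c'] by auto
qed (simp_all add: finite_index)

section \<open>Values and convexity of the cut paraboloids\<close>

lemma cap_cell: "y \<in> cell k c \<Longrightarrow> cap y (centre k c) = eps\<^sup>2 - sqdist y (centre k c)"
  by (simp add: cap_def cell_def)

lemma cap_not_cell: "y \<notin> cell k c \<Longrightarrow> cap y (centre k c) = 0"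
  by (simp add: cap_def cell_def)

lemma sqdist_nonneg: "sqdist y z \<ge> 0"
  unfolding sqdist_def by (intro sum_nonneg) auto

lemma cap_bounds: "0 \<le> cap y z" "cap y z \<le> eps\<^sup>2"
  using sqdist_nonneg[of y z] by (auto simp: cap_def)

lemma cap_other:
  assumes "k \<in> index" "i \<in> index" "y \<in> cell k c" "(i, d) \<noteq> (k, c)"
  shows "cap y (centre i d) = 0"
proof (rule cap_not_cell)
  show "y \<notin> cell i d"
    using cells_disjoint[OF assms(2,1), of y d c] assms(3,4) by auto
qed

lemma cut_all_cell:
  assumes "k \<in> index" "y \<in> cell k c"
  shows "cut_all y = quad y + cap y (centre k c)"
proof -
  have "(\<Sum>i\<in>index. cap y (centre i True) + cap y (centre i False)) = (\<Sum>i\<in>index. if i = k then cap y (centre k c) else 0)"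
  proof (rule sum.cong)
    fix i assume i: "i \<in> index"
    show "cap y (centre i True) + cap y (centre i False) = (if i = k then cap y (centre k c) else 0)"
      using cap_other[OF assms(1) i assms(2), of True] cap_other[OF assms(1) i assms(2), of False]
      by (cases c) auto
  qed simp
  then show ?thesis
    using assms finite_index by (simp add: cut_all_def)
qed

lemma cut_cell:
  assumes "k \<in> index" "y \<in> cell k c"
  shows "cut S y = quad y + (if c = (k \<in> S) then cap y (centre k c) else 0)"
proof -
  have "(\<Sum>i\<in>index. cap y (centre i (i \<in> S))) = (\<Sum>i\<in>index. if i = k then (if c = (k \<in> S) then cap y (centre k c) else 0) else 0)"
  proof (rule sum.cong)
    fix i assume i: "i \<in> index"
    show "cap y (centre i (i \<in> S)) = (if i = k then (if c = (k \<in> S) then cap y (centre k c) else 0) else 0)"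
      using cap_other[OF assms(1) i assms(2), of "i \<in> S"] by auto
  qed simp
  then show ?thesis
    using assms finite_index by (simp add: cut_def)
qed

text \<open>Inside a cell only its own cap is nonzero, so \<open>cut S\<close> is
  \<open>cut_all\<close> on the chosen cells and \<open>quad\<close> elsewhere. This connects the
  convex functions with the hypercube.\<close>

lemma cut_patched: "cut S = patched cell index quad cut_all S"
proof
  fix y
  show "cut S y = patched cell index quad cut_all S y"
  proof (cases "\<exists>k\<in>index. \<exists>c. y \<in> cell k c")
    case True
    then obtain k c where kc: "k \<in> index" "y \<in> cell k c" by blast
    then show ?thesis
      unfolding patched_cell[OF kc] cut_cell[OF kc] cut_all_cell[OF kc] by simp
  next
    case False
    then have "cut S y = quad y" "y \<notin> (\<Union>k\<in>index. cell k (k \<in> S))"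
      by (auto simp: cut_def cap_not_cell)
    then show ?thesis
      by (simp add: patched_def)
  qed
qed

lemma cut_all_not_cell:
  assumes "\<And>k c. k \<in> index \<Longrightarrow> y \<notin> cell k c"
  shows "cut_all y = quad y"
  using assms by (simp add: cut_all_def cap_not_cell)

text \<open>Caps over disjoint cells do not add up, so the increment is at most
  \<open>eps\<^sup>2 \<le> 1 / 4\<close>, here rounded up to 1.\<close>

lemma cut_all_bounds: "quad y \<le> cut_all y" "cut_all y \<le> quad y + 1"
proof -
  have "quad y \<le> cut_all y \<and> cut_all y \<le> quad y + 1"
  proof (cases "\<exists>k\<in>index. \<exists>c. y \<in> cell k c")
    case True
    then obtain k c where kc: "k \<in> index" "y \<in> cell k c" by blast
    show ?thesis
      unfolding cut_all_cell[OF kc] using cap_bounds[of y "centre k c"] eps_le by linarith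
  next
    case False
    then show ?thesis
      using cut_all_not_cell[of y] by auto
  qed
  then show "quad y \<le> cut_all y" "cut_all y \<le> quad y + 1" by auto
qed

lemma cut_bounds: "quad y \<le> cut S y" "cut S y \<le> quad y + 1"
  using cut_all_bounds[of y] by (auto simp: cut_patched patched_def)

lemma quad_nonneg: "quad y \<ge> 0"
  unfolding quad_def by (intro sum_nonneg) auto

lemma quad_le_dom:
  assumes "y \<in> dom"
  shows "quad y \<le> 4 * real (card B)"
proof -
  have "quad y \<le> (\<Sum>b\<in>B. 2\<^sup>2)"
    unfolding quad_def using assms by (intro sum_mono power_mono) (auto simp: dom_def)
  then show ?thesis by simp
qed

text \<open>The truncated paraboloid is a maximum of the paraboloid and the affine functions
  \<open>quad y + (eps\<^sup>2 - sqdist y z)\<close>, whence its convexity.\<close>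

lemma convex_cut: "convex_on UNIV (cut S)"
proof (rule convex_onI)
  fix t :: real and x y :: 'a
  assume t: "0 < t" "t < 1"
  let ?u = "(1 - t) *\<^sub>R x + t *\<^sub>R y"
  have le_cut: "quad v + (eps\<^sup>2 - sqdist v (centre k (k \<in> S))) \<le> cut S v" if "k \<in> index" for k v
  proof -
    have "cap v (centre k (k \<in> S)) \<le> (\<Sum>k\<in>index. cap v (centre k (k \<in> S)))"
      using that finite_index cap_bounds by (intro member_le_sum) auto
    then show ?thesis
      by (simp add: cut_def cap_def)
  qed
  have sq: "((1 - t) * p + t * q)\<^sup>2 \<le> (1 - t) * p\<^sup>2 + t * q\<^sup>2" for p q :: real
  proof -
    have "(1 - t) * p\<^sup>2 + t * q\<^sup>2 - ((1 - t) * p + t * q)\<^sup>2 = t * (1 - t) * (p - q)\<^sup>2"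
      by (simp add: power2_eq_square algebra_simps)
    also have "\<dots> \<ge> 0"
      using t by simp
    finally show ?thesis by simp
  qed
  show "cut S ?u \<le> (1 - t) * cut S x + t * cut S y"
  \<comment> \<open>In a chosen cell \<open>cut S\<close> equals an affine function lying below
    \<open>cut S\<close> everywhere; elsewhere it equals the convex \<open>quad\<close>, which also
    lies below. Either one supports the inequality at \<open>?u\<close>.\<close>
  proof (cases "\<exists>k\<in>index. ?u \<in> cell k (k \<in> S)")
    case True
    then obtain k where k: "k \<in> index" "?u \<in> cell k (k \<in> S)" by blast
    let ?l = "\<lambda>v. quad v + (eps\<^sup>2 - sqdist v (centre k (k \<in> S)))"
    have affine: "?l v = eps\<^sup>2 + (\<Sum>b\<in>B. 2 * centre k (k \<in> S) b * (v \<bullet> b) - (centre k (k \<in> S) b)\<^sup>2)" for v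
      unfolding quad_def sqdist_def
      by (simp add: sum_subtractf sum.distrib power2_diff sum_distrib_left mult_ac)
    have "cut S ?u = ?l ?u"
      using cut_cell[OF k] cap_cell[OF k(2)] by simp
    also have "\<dots> = (1 - t) * ?l x + t * ?l y"
    proof -
      have "(\<Sum>b\<in>B. 2 * centre k (k \<in> S) b * (?u \<bullet> b) - (centre k (k \<in> S) b)\<^sup>2)
        = (\<Sum>b\<in>B. (1 - t) * (2 * centre k (k \<in> S) b * (x \<bullet> b) - (centre k (k \<in> S) b)\<^sup>2)
            + t * (2 * centre k (k \<in> S) b * (y \<bullet> b) - (centre k (k \<in> S) b)\<^sup>2))"
        by (intro sum.cong refl) (simp add: inner_add_left algebra_simps)
      also have "\<dots> = (1 - t) * (\<Sum>b\<in>B. 2 * centre k (k \<in> S) b * (x \<bullet> b) - (centre k (k \<in> S) b)\<^sup>2)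
            + t * (\<Sum>b\<in>B. 2 * centre k (k \<in> S) b * (y \<bullet> b) - (centre k (k \<in> S) b)\<^sup>2)"
        by (simp only: sum.distrib sum_distrib_left)
      finally show ?thesis
        unfolding affine by (simp add: algebra_simps)
    qed
    also have "\<dots> \<le> (1 - t) * cut S x + t * cut S y"
      using t le_cut[OF k(1)] by (intro add_mono mult_left_mono) auto
    finally show ?thesis .
  next
    case False
    then have "cut S ?u = quad ?u"
      by (simp add: cut_def cap_not_cell)
    also have "\<dots> \<le> (\<Sum>b\<in>B. (1 - t) * (x \<bullet> b)\<^sup>2 + t * (y \<bullet> b)\<^sup>2)"
      unfolding quad_def by (intro sum_mono) (use sq in \<open>simp add: inner_add_left\<close>)
    also have "\<dots> = (1 - t) * quad x + t * quad y"
      by (simp add: quad_def sum.distrib sum_distrib_left)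
    also have "\<dots> \<le> (1 - t) * cut S x + t * cut S y"
      using t cut_bounds by (intro add_mono mult_left_mono) auto
    finally show ?thesis .
  qed
qed simp

text \<open>Translation by this vector carries the cap at the origin to the cap at
  \<open>z\<close>.\<close>

definition shift :: "('a \<Rightarrow> real) \<Rightarrow> 'a" where
  "shift z = (\<Sum>b\<in>B. z b *\<^sub>R b)"

lemma inner_shift: "i \<in> Basis \<Longrightarrow> shift z \<bullet> i = (if i \<in> B then z i else 0)"
proof -
  assume i: "i \<in> Basis"
  have "shift z \<bullet> i = (\<Sum>b\<in>B. if b = i then z b else 0)"
    unfolding shift_def inner_sum_left using i B_sub by (intro sum.cong) (auto simp: inner_Basis)
  then show ?thesis
    using finite_B by simp
qed

lemma sqdist_shift: "sqdist (shift z + y) z = sqdist y (\<lambda>_. 0)"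
  unfolding sqdist_def using B_sub by (intro sum.cong) (auto simp: inner_add_left inner_shift)

end

section \<open>Densities given by the graph of a truncated paraboloid\<close>

context grid
begin

text \<open>On \<open>dom\<close>, \<open>quad\<close> is at most \<open>4 * card B\<close> and the
  caps add at most 1; the last unit leaves a margin of 1 above \<open>cut S\<close>.\<close>

definition height :: real where "height = 4 * real (card B) + 2"

lemma height_pos: "height \<ge> 1"
  by (simp add: height_def)

lemma dom_height:
  assumes "y \<in> dom"
  shows "quad y \<le> height - 1" "cut_all y \<le> height - 1" "cut S y \<le> height - 1"
  using quad_le_dom[OF assms] cut_all_bounds(2)[of y] cut_bounds(2)[of S y] by (auto simp: height_def)

definition cap_mass :: ennreal where
  "cap_mass = (\<integral>\<^sup>+ y. ennreal (cap y (\<lambda>_. 0)) \<partial>lborel)"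

text \<open>By translation invariance the mass of a cap does not depend on its centre, so every cell
  loses the same mass.\<close>

lemma nn_integral_cap: "(\<integral>\<^sup>+ y. ennreal (cap y z) \<partial>lborel) = cap_mass"
proof -
  have "cap_mass = (\<integral>\<^sup>+ y. ennreal (cap (shift z + y) z) \<partial>lborel)"
    unfolding cap_mass_def by (simp add: cap_def sqdist_shift)
  also have "\<dots> = (\<integral>\<^sup>+ y. ennreal (cap y z) \<partial>lborel)"
    by (rule nn_integral_lborel_translate) measurable
  finally show ?thesis ..
qed

text \<open>On \<open>dom\<close> the functions \<open>height - cut S\<close> are concave with
  values between 1 and \<open>height\<close>. A cap changes them by at most
  \<open>eps\<^sup>2\<close> on a volume of order \<open>eps ^ card B\<close>, and away from 0 the
  root is Lipschitz, so a cell has squared Hellinger size of order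
  \<open>eps ^ (card B + 4)\<close>.\<close>

lemma graph_risk:
  fixes est :: "(nat \<Rightarrow> 'a) \<Rightarrow> 'a \<Rightarrow> real"
  assumes B: "B = Basis" and est: "est \<in> estimators n"
    and n: "real n * (eps ^ 4 * (2 * eps) ^ card B) \<le> 1 / 4"
  shows "ennreal (real (card index) * (eps ^ 4 / (16 * height) * (eps / real (card B)) ^ card B
      / (height * 2 ^ card B)) / 8) \<le> (SUP f\<in>log_concave_densities. hellinger_risk n est f)"
proof -
  define g0 where "g0 y = (if y \<in> dom then height - quad y else 0)" for y
  define g1 where "g1 y = (if y \<in> dom then height - cut_all y else 0)" for y
  have meas[measurable]: "g0 \<in> borel_measurable borel" "g1 \<in> borel_measurable borel"
    unfolding g0_def[abs_def] g1_def[abs_def] by measurable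
  have patched_eq: "patched cell index g0 g1 S y = (if y \<in> dom then height - cut S y else 0)" for S y
    by (simp add: cut_patched patched_def g0_def g1_def)
  have g_cell: "g0 y = height - quad y" "g1 y = g0 y - cap y (centre k c)"
    if "k \<in> index" "y \<in> cell k c" for y k c
    using that cell_subset_dom[OF that(1)] cut_all_cell[OF that] by (auto simp: g0_def g1_def)
  have vol_dom: "emeasure lborel dom = ennreal (2 ^ card B)"
    unfolding dom_def unfolding B by (subst emeasure_box_coords) simp_all
  have vol_cube: "emeasure lborel {y. \<forall>b\<in>Basis. z b - r \<le> y \<bullet> b \<and> y \<bullet> b \<le> z b + r} = ennreal ((2 * r) ^ card B)"
    if "r \<ge> 0" for z :: "'a \<Rightarrow> real" and r
    unfolding B using that by (subst emeasure_box_coords) simp_all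
  have cube_borel[measurable]: "{y. \<forall>b\<in>Basis. l b \<le> y \<bullet> b \<and> y \<bullet> b \<le> u b} \<in> sets borel" for l u :: "'a \<Rightarrow> real"
    unfolding box_coords by simp
  have cell_sub: "cell k c \<subseteq> {y. \<forall>b\<in>Basis. centre k c b - eps \<le> y \<bullet> b \<and> y \<bullet> b \<le> centre k c b + eps}" for k c
  proof
    fix y assume "y \<in> cell k c"
    then have "\<bar>y \<bullet> b - centre k c b\<bar> < eps" if "b \<in> Basis" for b
      using that B unfolding cell_def by (intro sqdist_coord) auto
    then show "y \<in> {y. \<forall>b\<in>Basis. centre k c b - eps \<le> y \<bullet> b \<and> y \<bullet> b \<le> centre k c b + eps}"
      by (auto simp: abs_less_iff) (smt (verit))+
  qed
  have "(\<integral>\<^sup>+ y\<in>cell k c. ennreal (g0 y - g1 y) \<partial>lborel) = cap_mass" if "k \<in> index" for k c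
  proof -
    have "(\<integral>\<^sup>+ y\<in>cell k c. ennreal (g0 y - g1 y) \<partial>lborel) = (\<integral>\<^sup>+ y. ennreal (cap y (centre k c)) \<partial>lborel)"
      by (intro nn_integral_cong) (auto simp: g_cell[OF that] cap_not_cell split: split_indicator)
    then show ?thesis
      by (simp add: nn_integral_cap)
  qed
  note mass = this
  have "cap_mass < \<infinity>"
  proof -
    let ?C = "{y :: 'a. \<forall>b\<in>Basis. 0 - eps \<le> y \<bullet> b \<and> y \<bullet> b \<le> 0 + eps}"
    have "cap_mass \<le> (\<integral>\<^sup>+ y. indicator ?C y \<partial>lborel)"
      unfolding cap_mass_def
    proof (rule nn_integral_mono)
      fix y :: 'a
      show "ennreal (cap y (\<lambda>_. 0)) \<le> indicator ?C y"
      proof (cases "sqdist y (\<lambda>_. 0) < eps\<^sup>2")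
        case True
        then have "y \<in> ?C"
          using sqdist_coord[OF True] B by (force simp: abs_less_iff)
        moreover have "cap y (\<lambda>_. 0) \<le> 1"
          using cap_bounds(2)[of y "\<lambda>_. 0"] eps_le by linarith
        ultimately show ?thesis
          by simp
      qed (simp add: cap_def)
    qed
    also have "\<dots> = ennreal ((2 * eps) ^ card B)"
      using vol_cube[of eps "\<lambda>_. 0"] eps_pos by simp
    also have "\<dots> < \<infinity>"
      by simp
    finally show ?thesis .
  qed
  note mass_fin = this
  show ?thesis
  proof (rule assouad_unnormalized[where K = "\<lambda>_. dom" and h = "\<lambda>S y. height - cut S y", OF meas _ _ mass mass_fin])
    fix y
    show "0 \<le> g1 y" "g1 y \<le> g0 y"
      using dom_height[of y] cut_all_bounds(1)[of y] by (auto simp: g0_def g1_def)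
  next
    fix S
    \<comment> \<open>The values on \<open>dom\<close> are at least 1, so the mass is at least the
      volume of \<open>dom\<close>.\<close>
    have "emeasure lborel dom = (\<integral>\<^sup>+ y. indicator dom y \<partial>lborel)"
      by simp
    also have "\<dots> \<le> (\<integral>\<^sup>+ y. ennreal (patched cell index g0 g1 S y) \<partial>lborel)"
    proof (rule nn_integral_mono)
      fix y show "indicator dom y \<le> ennreal (patched cell index g0 g1 S y)"
        using dom_height(3)[of y S] by (auto simp: patched_eq split: split_indicator)
    qed
    finally have "ennreal (2 ^ card B) \<le> (\<integral>\<^sup>+ y. ennreal (patched cell index g0 g1 S y) \<partial>lborel)"
      unfolding vol_dom .
    moreover have "1 \<le> ennreal (2 ^ card B)"
      by simp
    ultimately show "1 \<le> (\<integral>\<^sup>+ y. ennreal (patched cell index g0 g1 S y) \<partial>lborel)"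
      by (rule order_trans[rotated])
    have "(\<integral>\<^sup>+ y. ennreal (patched cell index g0 g1 S y) \<partial>lborel) \<le> (\<integral>\<^sup>+ y. ennreal height * indicator dom y \<partial>lborel)"
    proof (rule nn_integral_mono)
      fix y
      have "height - cut S y \<le> height"
        using cut_bounds(1)[of y S] quad_nonneg[of y] by simp
      then show "ennreal (patched cell index g0 g1 S y) \<le> ennreal height * indicator dom y"
        by (auto simp: patched_eq ennreal_leI split: split_indicator)
    qed
    also have "\<dots> = ennreal height * emeasure lborel dom"
      by (rule nn_integral_cmult_indicator) measurable
    also have "\<dots> = ennreal (height * 2 ^ card B)"
      unfolding vol_dom using height_pos by (intro ennreal_mult[symmetric]) auto
    finally show "(\<integral>\<^sup>+ y. ennreal (patched cell index g0 g1 S y) \<partial>lborel) \<le> ennreal (height * 2 ^ card B)" .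
    show "continuous_on dom (\<lambda>y. height - cut S y)"
      by (intro continuous_intros)
    show "concave_on dom (\<lambda>y. height - cut S y)"
      using convex_on_subset[OF convex_cut[of S] subset_UNIV] convex_dom
      by (intro concave_on_diff) (auto simp: concave_on_const)
    show "height - cut S y > 0" if "y \<in> dom" for y
      using dom_height(3)[OF that, of S] by simp
  next
    fix k c assume k: "k \<in> index"
    \<comment> \<open>The half-side from \<open>sqdist_le_box\<close>: the cube \<open>?Q\<close>
      lies in the cell, and the cap has height at least \<open>eps\<^sup>2 / 2\<close> on
      it.\<close>
    let ?r = "eps / (2 * real (card B))"
    let ?Q = "{y. \<forall>b\<in>Basis. centre k c b - ?r \<le> y \<bullet> b \<and> y \<bullet> b \<le> centre k c b + ?r}"
    have vol_Q: "emeasure lborel ?Q = ennreal ((eps / real (card B)) ^ card B)"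
      using vol_cube[of ?r "centre k c"] eps_pos by simp
    have "ennreal (eps ^ 4 / (16 * height) * (eps / real (card B)) ^ card B)
        = ennreal (eps ^ 4 / (16 * height)) * emeasure lborel ?Q"
      unfolding vol_Q using eps_pos height_pos by (intro ennreal_mult) auto
    also have "\<dots> = (\<integral>\<^sup>+ y. ennreal (eps ^ 4 / (16 * height)) * indicator ?Q y \<partial>lborel)"
      by (rule nn_integral_cmult_indicator[symmetric]) measurable
    also have "\<dots> \<le> hellinger_on (cell k c) g0 g1"
      unfolding hellinger_on_def
    proof (rule nn_integral_mono)
      fix y
      show "ennreal (eps ^ 4 / (16 * height)) * indicator ?Q y
        \<le> ennreal ((sqrt (g0 y) - sqrt (g1 y))\<^sup>2) * indicator (cell k c) y"
      proof (cases "y \<in> ?Q")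
        case True
        have "\<bar>y \<bullet> b - centre k c b\<bar> \<le> ?r" if "b \<in> B" for b
          using True that B by (auto simp: abs_le_iff)
        from sqdist_le_box[OF this] have sq: "sqdist y (centre k c) \<le> eps\<^sup>2 / 4" .
        moreover have "eps\<^sup>2 > 0"
          using eps_pos by simp
        ultimately have "sqdist y (centre k c) < eps\<^sup>2"
          by linarith
        then have y: "y \<in> cell k c"
          by (simp add: cell_def)
        have c: "eps\<^sup>2 / 2 \<le> cap y (centre k c)"
          using cap_cell[OF y] sq zero_le_power2[of eps] by linarith
        have yd: "y \<in> dom"
          using y cell_subset_dom[OF k] by auto
        have "eps ^ 4 / (16 * height) = (eps\<^sup>2 / 2)\<^sup>2 / (4 * height)"
          by (simp add: power_divide power_mult[symmetric])
        also have "\<dots> \<le> (g0 y - g1 y)\<^sup>2 / (4 * height)"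
          using c height_pos g_cell[OF k y] by (intro divide_right_mono power_mono) auto
        also have "\<dots> \<le> (sqrt (g0 y) - sqrt (g1 y))\<^sup>2"
          using dom_height[OF yd] cut_all_bounds(1)[of y] quad_nonneg[of y] height_pos yd
          by (intro sqrt_diff_sq_ge) (auto simp: g0_def g1_def)
        finally show ?thesis
          using y by (auto simp: ennreal_leI split: split_indicator)
      qed simp
    qed
    finally show "ennreal (eps ^ 4 / (16 * height) * (eps / real (card B)) ^ card B) \<le> hellinger_on (cell k c) g0 g1" .
    let ?P = "{y. \<forall>b\<in>Basis. centre k c b - eps \<le> y \<bullet> b \<and> y \<bullet> b \<le> centre k c b + eps}"
    have "hellinger_on (cell k c) g0 g1 \<le> (\<integral>\<^sup>+ y. ennreal (eps ^ 4) * indicator ?P y \<partial>lborel)"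
      unfolding hellinger_on_def
    proof (rule nn_integral_mono)
      fix y
      show "ennreal ((sqrt (g0 y) - sqrt (g1 y))\<^sup>2) * indicator (cell k c) y \<le> ennreal (eps ^ 4) * indicator ?P y"
      proof (cases "y \<in> cell k c")
        case True
        have yd: "y \<in> dom"
          using True cell_subset_dom[OF k] by auto
        \<comment> \<open>The margin of 1 below \<open>height\<close> keeps both values at least
          1.\<close>
        have "(sqrt (g0 y) - sqrt (g1 y))\<^sup>2 \<le> (g0 y - g1 y)\<^sup>2"
          using dom_height[OF yd] cut_all_bounds(1)[of y] yd
          by (intro sqrt_diff_sq_le_sq) (auto simp: g0_def g1_def)
        also have "\<dots> \<le> (eps\<^sup>2)\<^sup>2"
          using g_cell[OF k True] cap_bounds[of y "centre k c"] by (intro power_mono) auto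
        also have "\<dots> = eps ^ 4"
          by (simp add: power_mult[symmetric])
        finally have "ennreal ((sqrt (g0 y) - sqrt (g1 y))\<^sup>2) \<le> ennreal (eps ^ 4)"
          by (rule ennreal_leI)
        moreover have "y \<in> ?P"
          using True cell_sub by blast
        ultimately show ?thesis
          using True by (simp only: indicator_simps mult_1_right)
      qed simp
    qed
    also have "\<dots> = ennreal (eps ^ 4) * emeasure lborel ?P"
      by (rule nn_integral_cmult_indicator) measurable
    also have "\<dots> = ennreal (eps ^ 4 * (2 * eps) ^ card B)"
      unfolding vol_cube[OF less_imp_le[OF eps_pos]] using eps_pos by (intro ennreal_mult[symmetric]) auto
    finally show "hellinger_on (cell k c) g0 g1 \<le> ennreal (eps ^ 4 * (2 * eps) ^ card B)" .
  qed (use eps_pos height_pos n est in \<open>auto simp: patched_eq closed_dom convex_dom\<close>)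
qed

end

text \<open>For dimension \<open>d\<close> this is \<open>minimax_rate\<close> with
  \<open>k = d\<close> and \<open>a = d + 4\<close>. The exponent is \<open>-4/5\<close> for
  \<open>d = 1\<close> and coincides with \<open>-2/(d+1)\<close> for \<open>d = 2\<close>; in
  higher dimensions the bodies below give a slower decay.\<close>

lemma graph_minimax:
  "\<exists>c>0. \<forall>n\<ge>1. ennreal (c * real n powr (- 4 / (real DIM('a) + 4)))
      \<le> (INF est\<in>estimators n. SUP f\<in>(log_concave_densities :: ('a::euclidean_space \<Rightarrow> real) set). hellinger_risk n est f)"
proof -
  let ?d = "DIM('a)"
  define H where "H = 4 * real ?d + 2"
  \<comment> \<open>Collects the constants of \<open>graph_risk\<close> once the powers of
    \<open>N\<close> are taken out.\<close>
  define K2 where "K2 = 1 / (16 * (16 * H)) * (1 / (2 * real ?d)) ^ ?d / (H * 2 ^ ?d) / 8"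
  have "\<exists>c>0. \<forall>n\<ge>1. ennreal (c * real n powr (- (real (?d + 4) - real ?d) / real (?d + 4)))
      \<le> (INF est\<in>estimators n. SUP f\<in>(log_concave_densities :: ('a \<Rightarrow> real) set). hellinger_risk n est f)"
  \<comment> \<open>The constant 1/16 comes from
    \<open>eps ^ 4 * (2 * eps) ^ ?d = 1 / 16 / N ^ (?d + 4)\<close>.\<close>
  proof (rule minimax_rate[where ?K1.0 = "1 / 16" and ?K2.0 = K2])
    show "K2 > 0"
      by (simp add: K2_def H_def add_pos_pos)
    fix N n and est :: "(nat \<Rightarrow> 'a) \<Rightarrow> 'a \<Rightarrow> real"
    assume N: "1 \<le> N" and est: "est \<in> estimators n" and n: "real n * (1 / 16 / real N ^ (?d + 4)) \<le> 1 / 4"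
    interpret grid "Basis :: 'a set" N
      by standard (use N in auto)
    have "eps ^ 4 * (2 * eps) ^ ?d = 1 / 16 / real N ^ (?d + 4)"
      by (simp add: eps_def power_divide power_mult_distrib power_add)
    with n have "real n * (eps ^ 4 * (2 * eps) ^ ?d) \<le> 1 / 4"
      by simp
    from graph_risk[OF refl est this]
    have "ennreal (real (card index) * (eps ^ 4 / (16 * height) * (eps / real ?d) ^ ?d / (height * 2 ^ ?d)) / 8)
      \<le> (SUP f\<in>log_concave_densities. hellinger_risk n est f)" .
    also have "real (card index) * (eps ^ 4 / (16 * height) * (eps / real ?d) ^ ?d / (height * 2 ^ ?d)) / 8
        = real N ^ ?d * (K2 / real N ^ (?d + 4))"
    proof -
      have "eps ^ 4 = 1 / 16 / real N ^ 4"
        by (simp add: eps_def power_divide power_mult_distrib)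
      moreover have "(eps / real ?d) ^ ?d = (1 / (2 * real ?d)) ^ ?d / real N ^ ?d"
        by (simp add: eps_def power_divide power_mult_distrib)
      moreover have "height = H"
        by (simp add: height_def H_def)
      ultimately show ?thesis
        by (simp add: K2_def card_index power_add)
    qed
    finally show "ennreal (real N ^ ?d * (K2 / real N ^ (?d + 4)))
      \<le> (SUP f\<in>log_concave_densities. hellinger_risk n est f)" .
  qed auto
  then show ?thesis
    by simp
qed

section \<open>Uniform densities on truncated paraboloids\<close>

text \<open>Fubini along the direction \<open>e\<close>, with the other coordinates as
  parameters.\<close>

lemma nn_integral_lborel_slices:
  fixes F :: "'a::euclidean_space \<Rightarrow> ennreal"
  assumes [measurable]: "F \<in> borel_measurable borel" and e: "e \<in> Basis"
  shows "(\<integral>\<^sup>+ y. F y \<partial>lborel)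
    = (\<integral>\<^sup>+ x. (\<integral>\<^sup>+ t. F (\<Sum>b\<in>Basis. (x(e := t)) b *\<^sub>R b) \<partial>lborel) \<partial>Pi\<^sub>M (Basis - {e}) (\<lambda>_. lborel))"
proof -
  interpret L: product_sigma_finite "\<lambda>_::'a. lborel :: real measure"
    by standard
  have ins: "insert e (Basis - {e}) = Basis"
    using e by auto
  have "(\<integral>\<^sup>+ y. F y \<partial>lborel) = (\<integral>\<^sup>+ x. F (\<Sum>b\<in>Basis. x b *\<^sub>R b) \<partial>Pi\<^sub>M Basis (\<lambda>_. lborel))"
    by (subst lborel_eq) (simp add: nn_integral_distr)
  also have "\<dots> = (\<integral>\<^sup>+ x. F (\<Sum>b\<in>Basis. x b *\<^sub>R b) \<partial>Pi\<^sub>M (insert e (Basis - {e})) (\<lambda>_. lborel))"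
    unfolding ins ..
  also have "\<dots> = (\<integral>\<^sup>+ x. (\<integral>\<^sup>+ t. F (\<Sum>b\<in>Basis. (x(e := t)) b *\<^sub>R b) \<partial>lborel) \<partial>Pi\<^sub>M (Basis - {e}) (\<lambda>_. lborel))"
    by (subst L.product_nn_integral_insert) (simp_all add: ins)
  finally show ?thesis .
qed

text \<open>On each line parallel to \<open>e\<close> the function \<open>g\<close> is constant, so
  there the shear is a translation.\<close>

lemma nn_integral_lborel_shear:
  fixes F :: "'a::euclidean_space \<Rightarrow> ennreal" and g :: "'a \<Rightarrow> real"
  assumes F[measurable]: "F \<in> borel_measurable borel" and g[measurable]: "g \<in> borel_measurable borel"
    and e: "e \<in> Basis" and inv: "\<And>y r. g (y + r *\<^sub>R e) = g y"
  shows "(\<integral>\<^sup>+ y. F (y + g y *\<^sub>R e) \<partial>lborel) = (\<integral>\<^sup>+ y. F y \<partial>lborel)"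
proof -
  define Y where "Y x t = (\<Sum>b\<in>Basis. (x(e := t)) b *\<^sub>R b)" for x :: "'a \<Rightarrow> real" and t
  have Y_eq: "Y x t = t *\<^sub>R e + (\<Sum>b\<in>Basis - {e}. x b *\<^sub>R b)" for x t
    unfolding Y_def using e by (subst sum.remove[of _ e]) (auto intro!: sum.cong)
  have Y_add: "Y x t + c *\<^sub>R e = Y x (c + t)" for x t c
    by (simp add: Y_eq algebra_simps)
  have g_Y: "g (Y x t) = g (Y x 0)" for x t
    using inv[of "Y x 0" t] by (simp add: Y_add)
  have Y_meas[measurable]: "Y x \<in> borel_measurable borel" for x
    unfolding Y_eq[abs_def] by measurable
  have "(\<integral>\<^sup>+ y. F (y + g y *\<^sub>R e) \<partial>lborel)
      = (\<integral>\<^sup>+ x. (\<integral>\<^sup>+ t. F (Y x t + g (Y x t) *\<^sub>R e) \<partial>lborel) \<partial>Pi\<^sub>M (Basis - {e}) (\<lambda>_. lborel))"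
    unfolding Y_def by (rule nn_integral_lborel_slices[OF _ e]) measurable
  also have "\<dots> = (\<integral>\<^sup>+ x. (\<integral>\<^sup>+ t. F (Y x t) \<partial>lborel) \<partial>Pi\<^sub>M (Basis - {e}) (\<lambda>_. lborel))"
  proof (rule nn_integral_cong)
    fix x
    have "(\<integral>\<^sup>+ t. F (Y x t + g (Y x t) *\<^sub>R e) \<partial>lborel) = (\<integral>\<^sup>+ t. F (Y x (g (Y x 0) + t)) \<partial>lborel)"
      unfolding Y_add by (subst g_Y) simp
    also have "\<dots> = (\<integral>\<^sup>+ t. F (Y x t) \<partial>lborel)"
      by (rule nn_integral_lborel_translate[of "\<lambda>t. F (Y x t)"]) measurable
    finally show "(\<integral>\<^sup>+ t. F (Y x t + g (Y x t) *\<^sub>R e) \<partial>lborel) = (\<integral>\<^sup>+ t. F (Y x t) \<partial>lborel)" .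
  qed
  also have "\<dots> = (\<integral>\<^sup>+ y. F y \<partial>lborel)"
    unfolding Y_def by (rule nn_integral_lborel_slices[OF F e, symmetric])
  finally show ?thesis .
qed

text \<open>The direction \<open>e\<close> is vertical: bodies lie above graphs of functions of the
  coordinates in \<open>B\<close>.\<close>

locale body_grid = grid B N for B :: "'a::euclidean_space set" and N +
  fixes e :: 'a
  assumes e: "e \<in> Basis" and B_eq: "B = Basis - {e}"
begin

section \<open>Caps as regions above the paraboloid\<close>

lemma Basis_insert: "Basis = insert e B" "e \<notin> B"
  using e B_eq by auto

lemma inner_e: "b \<in> B \<Longrightarrow> e \<bullet> b = 0" "shift z \<bullet> e = 0" "e \<bullet> e = 1"
  using e B_eq inner_shift[OF e] by (auto simp: inner_Basis)

lemma quad_vertical: "quad (y + r *\<^sub>R e) = quad y"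
  unfolding quad_def by (intro sum.cong) (simp_all add: inner_add_left inner_e)

lemma cap_vertical: "cap (y + r *\<^sub>R e) z = cap y z"
proof -
  have "sqdist (y + r *\<^sub>R e) z = sqdist y z"
    unfolding sqdist_def by (intro sum.cong) (simp_all add: inner_add_left inner_e)
  then show ?thesis
    by (simp add: cap_def)
qed

text \<open>The cap region after a shear has flattened the paraboloid beneath it.\<close>

definition tip :: "('a \<Rightarrow> real) \<Rightarrow> 'a set" where
  "tip z = {y. 0 \<le> y \<bullet> e \<and> y \<bullet> e < cap y z}"

lemma tip_borel [measurable]: "tip z \<in> sets borel"
  unfolding tip_def by measurable

lemma emeasure_tip: "emeasure lborel (tip z) = emeasure lborel (tip (\<lambda>_. 0))"
proof -
  have "indicator (tip z) (shift z + y) = (indicator (tip (\<lambda>_. 0)) y :: ennreal)" for y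
    by (auto simp: tip_def cap_def sqdist_shift inner_add_left inner_e split: split_indicator)
  then have "(\<integral>\<^sup>+ y. indicator (tip (\<lambda>_. 0)) y \<partial>lborel) = (\<integral>\<^sup>+ y. indicator (tip z) (shift z + y) \<partial>lborel)"
    by simp
  also have "\<dots> = (\<integral>\<^sup>+ y. indicator (tip z) y \<partial>lborel)"
    by (rule nn_integral_lborel_translate) measurable
  finally show ?thesis
    by simp
qed

text \<open>The shear by \<open>- quad\<close> carries the region between paraboloid and hyperplane
  to \<open>tip z\<close>, and a translation moves that to the origin; hence all caps have equal
  volume.\<close>

lemma nn_integral_cap_region:
  "(\<integral>\<^sup>+ y. indicator {y. quad y \<le> y \<bullet> e \<and> y \<bullet> e < quad y + cap y z} y \<partial>lborel) = emeasure lborel (tip (\<lambda>_. 0))"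
proof -
  have "indicator {y. quad y \<le> y \<bullet> e \<and> y \<bullet> e < quad y + cap y z} y
      = (indicator (tip z) (y + (- quad y) *\<^sub>R e) :: ennreal)" for y
    unfolding tip_def indicator_def mem_Collect_eq cap_vertical
    by (auto simp: inner_diff_left inner_e)
  then have "(\<integral>\<^sup>+ y. indicator {y. quad y \<le> y \<bullet> e \<and> y \<bullet> e < quad y + cap y z} y \<partial>lborel)
    = (\<integral>\<^sup>+ y. indicator (tip z) (y + (- quad y) *\<^sub>R e) \<partial>lborel)"
    by presburger
  also have "\<dots> = (\<integral>\<^sup>+ y. indicator (tip z) y \<partial>lborel)"
    by (rule nn_integral_lborel_shear[OF _ _ e]) (simp_all only: quad_vertical, measurable)
  finally show ?thesis
    by (simp add: emeasure_tip[of z])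
qed

section \<open>Volumes of tips and truncated bodies\<close>

definition cylinder :: "real \<Rightarrow> real \<Rightarrow> real \<Rightarrow> real \<Rightarrow> 'a set" where
  "cylinder p q s t = {y. (\<forall>b\<in>B. p \<le> y \<bullet> b \<and> y \<bullet> b \<le> q) \<and> s \<le> y \<bullet> e \<and> y \<bullet> e \<le> t}"

lemma cylinder_eq_box: "cylinder p q s t = {y. \<forall>b\<in>Basis. (if b = e then s else p) \<le> y \<bullet> b \<and> y \<bullet> b \<le> (if b = e then t else q)}"
  unfolding cylinder_def Basis_insert(1) using Basis_insert(2) by auto

lemma cylinder_borel [measurable]: "cylinder p q s t \<in> sets borel"
  unfolding cylinder_eq_box box_coords by simp

lemma emeasure_cylinder:
  assumes "p \<le> q" "s \<le> t"
  shows "emeasure lborel (cylinder p q s t) = ennreal ((q - p) ^ card B * (t - s))"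
proof -
  have "(\<Prod>b\<in>B. (if b = e then t else q) - (if b = e then s else p)) = (\<Prod>b\<in>B. q - p)"
    using Basis_insert(2) by (intro prod.cong) auto
  then have "(\<Prod>b\<in>Basis. (if b = e then t else q) - (if b = e then s else p)) = (t - s) * (\<Prod>b\<in>B. q - p)"
    unfolding Basis_insert(1) using Basis_insert(2) finite_B by simp
  then show ?thesis
    unfolding cylinder_eq_box using assms by (subst emeasure_box_coords) (auto simp: mult.commute)
qed

text \<open>The tip lies in a box of width \<open>2 * eps\<close> and height
  \<open>eps\<^sup>2\<close>. It contains the cube of \<open>sqdist_le_box\<close> times height
  \<open>eps\<^sup>2 / 2\<close>, since the cap is at least \<open>3 / 4 * eps\<^sup>2\<close>
  there.\<close>

lemma tip_bounds:
  "emeasure lborel (tip (\<lambda>_. 0)) \<le> ennreal (eps\<^sup>2 * (2 * eps) ^ card B)"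
  "ennreal (eps\<^sup>2 / 2 * (eps / real (card B)) ^ card B) \<le> emeasure lborel (tip (\<lambda>_. 0))"
proof -
  have "tip (\<lambda>_. 0) \<subseteq> cylinder (- eps) eps 0 (eps\<^sup>2)"
  proof
    fix y assume y: "y \<in> tip (\<lambda>_. 0)"
    then have "sqdist y (\<lambda>_. 0) < eps\<^sup>2"
      by (auto simp: tip_def cap_def)
    from sqdist_coord[OF this] have "\<bar>y \<bullet> b\<bar> < eps" if "b \<in> B" for b
      using that by simp
    moreover have "y \<bullet> e \<le> eps\<^sup>2" "0 \<le> y \<bullet> e"
      using y cap_bounds(2)[of y "\<lambda>_. 0"] by (auto simp: tip_def)
    ultimately show "y \<in> cylinder (- eps) eps 0 (eps\<^sup>2)"
      by (force simp: cylinder_def abs_less_iff)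
  qed
  then have "emeasure lborel (tip (\<lambda>_. 0)) \<le> emeasure lborel (cylinder (- eps) eps 0 (eps\<^sup>2))"
    by (rule emeasure_mono) simp
  then show "emeasure lborel (tip (\<lambda>_. 0)) \<le> ennreal (eps\<^sup>2 * (2 * eps) ^ card B)"
    using eps_pos by (subst (asm) emeasure_cylinder) (auto simp: mult.commute)
  let ?r = "eps / (2 * real (card B))"
  have "cylinder (- ?r) ?r 0 (eps\<^sup>2 / 2) \<subseteq> tip (\<lambda>_. 0)"
  proof
    fix y assume y: "y \<in> cylinder (- ?r) ?r 0 (eps\<^sup>2 / 2)"
    have "sqdist y (\<lambda>_. 0) \<le> eps\<^sup>2 / 4"
    proof (rule sqdist_le_box)
      fix b assume "b \<in> B"
      with y show "\<bar>y \<bullet> b - 0\<bar> \<le> ?r"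
        by (auto simp: cylinder_def abs_le_iff)
    qed
    then have "eps\<^sup>2 - eps\<^sup>2 / 4 \<le> cap y (\<lambda>_. 0)"
      unfolding cap_def by linarith
    moreover have "eps\<^sup>2 > 0"
      using eps_pos by simp
    moreover have "0 \<le> y \<bullet> e" "y \<bullet> e \<le> eps\<^sup>2 / 2"
      using y by (auto simp: cylinder_def)
    ultimately have "0 \<le> y \<bullet> e" "y \<bullet> e < cap y (\<lambda>_. 0)"
      by linarith+
    then show "y \<in> tip (\<lambda>_. 0)"
      by (simp add: tip_def)
  qed
  then have "emeasure lborel (cylinder (- ?r) ?r 0 (eps\<^sup>2 / 2)) \<le> emeasure lborel (tip (\<lambda>_. 0))"
    by (rule emeasure_mono) simp
  moreover have "emeasure lborel (cylinder (- ?r) ?r 0 (eps\<^sup>2 / 2)) = ennreal (eps\<^sup>2 / 2 * (eps / real (card B)) ^ card B)"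
    using eps_pos by (subst emeasure_cylinder) (auto simp: mult.commute)
  ultimately show "ennreal (eps\<^sup>2 / 2 * (eps / real (card B)) ^ card B) \<le> emeasure lborel (tip (\<lambda>_. 0))"
    by simp
qed

definition body :: "('a \<Rightarrow> real) \<Rightarrow> 'a set" where
  "body w = {y \<in> dom. w y \<le> y \<bullet> e \<and> y \<bullet> e \<le> height}"

lemma body_borel [measurable]:
  assumes [measurable]: "w \<in> borel_measurable borel"
  shows "body w \<in> sets borel"
  unfolding body_def by measurable

lemma closed_body_cut: "closed (body (cut S))"
proof -
  have "body (cut S) = dom \<inter> ({y. cut S y \<le> y \<bullet> e} \<inter> {y. y \<bullet> e \<le> height})"
    by (auto simp: body_def)
  then show ?thesis
    by (auto intro!: closed_Int closed_dom closed_Collect_le continuous_intros)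
qed

lemma convex_body_cut: "convex (body (cut S))"
proof (rule convexI)
  fix x y :: 'a and u v :: real
  assume xy: "x \<in> body (cut S)" "y \<in> body (cut S)" and uv: "0 \<le> u" "0 \<le> v" "u + v = 1"
  let ?z = "u *\<^sub>R x + v *\<^sub>R y"
  have "?z \<in> dom"
    using xy uv by (intro convexD[OF convex_dom]) (auto simp: body_def)
  moreover have "cut S ?z \<le> u * cut S x + v * cut S y"
    using convex_onD[OF convex_cut, of v x y S] uv by (simp add: eq_diff_eq[symmetric])
  moreover have "u * cut S x + v * cut S y \<le> u * (x \<bullet> e) + v * (y \<bullet> e)"
    using xy uv by (intro add_mono mult_left_mono) (auto simp: body_def)
  moreover have "u * (x \<bullet> e) + v * (y \<bullet> e) \<le> u * height + v * height"
    using xy uv by (intro add_mono mult_left_mono) (auto simp: body_def)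
  moreover have "u * height + v * height = height"
    using uv by (simp add: distrib_right[symmetric])
  ultimately show "?z \<in> body (cut S)"
    by (simp add: body_def inner_add_left)
qed

text \<open>The top slab of thickness 1 over \<open>dom\<close> lies above \<open>cut S\<close>, and
  the whole body lies in a box of height \<open>height\<close>.\<close>

lemma body_cut_bounds:
  "ennreal (2 ^ card B) \<le> emeasure lborel (body (cut S))"
  "emeasure lborel (body (cut S)) \<le> ennreal (height * 2 ^ card B)"
proof -
  have "cylinder 0 2 (height - 1) height \<subseteq> body (cut S)"
    using dom_height(3)[of _ S] by (force simp: cylinder_def body_def dom_def)
  then have "emeasure lborel (cylinder 0 2 (height - 1) height) \<le> emeasure lborel (body (cut S))"
    by (rule emeasure_mono) simp
  then show "ennreal (2 ^ card B) \<le> emeasure lborel (body (cut S))"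
    by (simp add: emeasure_cylinder)
  have "body (cut S) \<subseteq> cylinder 0 2 0 height"
  proof
    fix y assume y: "y \<in> body (cut S)"
    then have "0 \<le> y \<bullet> e"
      using quad_nonneg[of y] cut_bounds(1)[of y S] by (auto simp: body_def)
    with y show "y \<in> cylinder 0 2 0 height"
      by (auto simp: body_def cylinder_def dom_def)
  qed
  then have "emeasure lborel (body (cut S)) \<le> emeasure lborel (cylinder 0 2 0 height)"
    by (rule emeasure_mono) simp
  then show "emeasure lborel (body (cut S)) \<le> ennreal (height * 2 ^ card B)"
    using height_pos by (simp add: emeasure_cylinder mult.commute)
qed

text \<open>For indicators the squared difference of roots is the difference itself, so the mass
  removed from a cell and its squared Hellinger size are both the volume of one cap, of order
  \<open>eps ^ (card B + 2)\<close>.\<close>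

lemma body_risk:
  fixes est :: "(nat \<Rightarrow> 'a) \<Rightarrow> 'a \<Rightarrow> real"
  assumes est: "est \<in> estimators n" and n: "real n * (eps\<^sup>2 * (2 * eps) ^ card B) \<le> 1 / 4"
  shows "ennreal (real (card index) * (eps\<^sup>2 / 2 * (eps / real (card B)) ^ card B
      / (height * 2 ^ card B)) / 8) \<le> (SUP f\<in>log_concave_densities. hellinger_risk n est f)"
proof -
  define g0 :: "'a \<Rightarrow> real" where "g0 = indicator (body quad)"
  define g1 :: "'a \<Rightarrow> real" where "g1 = indicator (body cut_all)"
  have meas[measurable]: "g0 \<in> borel_measurable borel" "g1 \<in> borel_measurable borel"
    unfolding g0_def g1_def by measurable
  have patched_eq: "patched cell index g0 g1 S y = indicator (body (cut S)) y" for S y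
    by (auto simp: cut_patched patched_def g0_def g1_def body_def split: split_indicator)
  have sub: "body cut_all \<subseteq> body quad"
    using cut_all_bounds(1) by (auto simp: body_def intro: order_trans)
  have sq_diff: "(sqrt (g0 y) - sqrt (g1 y))\<^sup>2 = g0 y - g1 y" for y
    using sub by (auto simp: g0_def g1_def split: split_indicator)
  have tip_cell: "(\<integral>\<^sup>+ y\<in>cell k c. ennreal (g0 y - g1 y) \<partial>lborel) = emeasure lborel (tip (\<lambda>_. 0))"
    if k: "k \<in> index" for k c
  proof -
    let ?R = "{y. quad y \<le> y \<bullet> e \<and> y \<bullet> e < quad y + cap y (centre k c)}"
    \<comment> \<open>Inside the cell the bodies differ exactly by the cap region, which stays below
      \<open>height\<close>; outside, the cap is zero and \<open>?R\<close> contains no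
      point.\<close>
    have "ennreal (g0 y - g1 y) * indicator (cell k c) y = indicator ?R y" for y
    proof (cases "y \<in> cell k c")
      case True
      then have "y \<in> dom"
        using cell_subset_dom[OF k] by auto
      then show ?thesis
        using True dom_height[of y] cut_all_cell[OF k True] cap_bounds(1)[of y "centre k c"]
        by (auto simp: g0_def g1_def body_def split: split_indicator)
    next
      case False
      then show ?thesis
        by (auto simp: cap_not_cell split: split_indicator)
    qed
    then show ?thesis
      using nn_integral_cap_region[of "centre k c"] by simp
  qed
  have hell: "hellinger_on (cell k c) g0 g1 = emeasure lborel (tip (\<lambda>_. 0))" if "k \<in> index" for k c
    unfolding hellinger_on_def sq_diff by (rule tip_cell[OF that])
  have mass: "(\<integral>\<^sup>+ y. ennreal (patched cell index g0 g1 S y) \<partial>lborel) = emeasure lborel (body (cut S))" for S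
    unfolding patched_eq by (simp add: ennreal_indicator)
  have fin: "emeasure lborel (tip (\<lambda>_. 0)) < \<infinity>"
    using tip_bounds(1) by (rule order_le_less_trans) simp
  show ?thesis
  proof (rule assouad_unnormalized[where K = "\<lambda>S. body (cut S)" and h = "\<lambda>_ _. 1", OF meas _ _ tip_cell fin])
    fix S
    have "1 \<le> ennreal (2 ^ card B)"
      by simp
    also note body_cut_bounds(1)[of S]
    finally show "1 \<le> (\<integral>\<^sup>+ y. ennreal (patched cell index g0 g1 S y) \<partial>lborel)"
      unfolding mass .
    show "(\<integral>\<^sup>+ y. ennreal (patched cell index g0 g1 S y) \<partial>lborel) \<le> ennreal (height * 2 ^ card B)"
      unfolding mass by (rule body_cut_bounds)
    show "concave_on (body (cut S)) (\<lambda>_. 1)"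
      using convex_body_cut by (simp add: concave_on_const)
    show "g1 y \<le> g0 y" "0 \<le> g1 y" for y
      using sub by (auto simp: g0_def g1_def split: split_indicator)
    show "patched cell index g0 g1 S y = (if y \<in> body (cut S) then 1 else 0)" for y
      by (simp add: patched_eq indicator_def)
  next
    fix k c assume k: "k \<in> index"
    show "ennreal (eps\<^sup>2 / 2 * (eps / real (card B)) ^ card B) \<le> hellinger_on (cell k c) g0 g1"
      unfolding hell[OF k] by (rule tip_bounds)
    show "hellinger_on (cell k c) g0 g1 \<le> ennreal (eps\<^sup>2 * (2 * eps) ^ card B)"
      unfolding hell[OF k] by (rule tip_bounds)
  qed (use eps_pos n est in \<open>simp_all add: closed_body_cut convex_body_cut\<close>)
qed

end

text \<open>With \<open>m\<close> horizontal directions in dimension \<open>m + 1\<close>,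
  \<open>minimax_rate\<close> applies with \<open>k = m\<close> and \<open>a = m + 2\<close>.
  Dimension at least 2 provides a horizontal direction.\<close>

lemma body_minimax:
  assumes dim: "DIM('a) \<ge> 2"
  shows "\<exists>c>0. \<forall>n\<ge>1. ennreal (c * real n powr (- 2 / (real DIM('a) + 1)))
      \<le> (INF est\<in>estimators n. SUP f\<in>(log_concave_densities :: ('a::euclidean_space \<Rightarrow> real) set). hellinger_risk n est f)"
proof -
  obtain e :: 'a where e: "e \<in> Basis"
    using nonempty_Basis by blast
  define m where "m = DIM('a) - 1"
  have m: "m \<ge> 1" "real DIM('a) = real m + 1" "card (Basis - {e}) = m"
    using dim e by (auto simp: m_def)
  define H where "H = 4 * real m + 2"
  define K2 where "K2 = 1 / 8 * (1 / (2 * real m)) ^ m / (H * 2 ^ m) / 8"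
  have "\<exists>c>0. \<forall>n\<ge>1. ennreal (c * real n powr (- (real (m + 2) - real m) / real (m + 2)))
      \<le> (INF est\<in>estimators n. SUP f\<in>(log_concave_densities :: ('a \<Rightarrow> real) set). hellinger_risk n est f)"
  \<comment> \<open>The constant 1/4 comes from
    \<open>eps\<^sup>2 * (2 * eps) ^ m = 1 / 4 / N ^ (m + 2)\<close>.\<close>
  proof (rule minimax_rate[where ?K1.0 = "1 / 4" and ?K2.0 = K2])
    show "K2 > 0"
      using m(1) by (simp add: K2_def H_def add_pos_pos)
    fix N n and est :: "(nat \<Rightarrow> 'a) \<Rightarrow> 'a \<Rightarrow> real"
    assume N: "1 \<le> N" and est: "est \<in> estimators n" and n: "real n * (1 / 4 / real N ^ (m + 2)) \<le> 1 / 4"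
    have "Basis - {e} \<noteq> {}"
      using m by (metis card.empty not_one_le_zero)
    then interpret body_grid "Basis - {e}" N e
      using N e by unfold_locales auto
    have "eps\<^sup>2 * (2 * eps) ^ m = 1 / 4 / real N ^ (m + 2)"
      by (simp add: eps_def power_divide power_mult_distrib power_add power2_eq_square)
    with n have "real n * (eps\<^sup>2 * (2 * eps) ^ card (Basis - {e})) \<le> 1 / 4"
      unfolding m(3) by simp
    from body_risk[OF est this]
    have "ennreal (real (card index) * (eps\<^sup>2 / 2 * (eps / real m) ^ m / (height * 2 ^ m)) / 8)
      \<le> (SUP f\<in>log_concave_densities. hellinger_risk n est f)"
      unfolding m(3) .
    also have "real (card index) * (eps\<^sup>2 / 2 * (eps / real m) ^ m / (height * 2 ^ m)) / 8
        = real N ^ m * (K2 / real N ^ (m + 2))"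
    proof -
      have "eps\<^sup>2 = 1 / 4 / real N ^ 2"
        by (simp add: eps_def power_divide power_mult_distrib)
      moreover have "(eps / real m) ^ m = (1 / (2 * real m)) ^ m / real N ^ m"
        by (simp add: eps_def power_divide power_mult_distrib)
      moreover have "height = H"
        unfolding height_def H_def m(3) ..
      moreover have "card index = N ^ m"
        unfolding card_index m(3) ..
      ultimately show ?thesis
        by (simp add: K2_def power_add power2_eq_square)
    qed
    finally show "ennreal (real N ^ m * (K2 / real N ^ (m + 2)))
      \<le> (SUP f\<in>log_concave_densities. hellinger_risk n est f)" .
  qed auto
  moreover have "- (real (m + 2) - real m) / real (m + 2) = - 2 / (real DIM('a) + 1)"
    by (simp add: m(2) add.commute)
  ultimately show ?thesis
    by (simp only:)
qed

theorem theorem1: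
  shows "\<exists>c::real. c > 0 \<and> (\<forall>n\<ge>CARD('d::finite) + 1.
    (INF est \<in> estimators n.
       SUP f \<in> (log_concave_densities :: (real ^ 'd \<Rightarrow> real) set). hellinger_risk n est f)
    \<ge> ennreal (if CARD('d) = 1 then c * real n powr (- 4 / 5)
               else c * real n powr (- 2 / (real CARD('d) + 1))))"
proof (cases "CARD('d) = 1")
  case True
  \<comment> \<open>In dimension 1 the exponent \<open>- 4 / (d + 4)\<close> is
    \<open>- 4 / 5\<close>.\<close>
  then show ?thesis
    using graph_minimax[where 'a = "real ^ 'd"] by auto
next
  case False
  moreover have "CARD('d) > 0"
    by simp
  ultimately have "CARD('d) \<ge> 2"
    by linarith
  then have "DIM(real ^ 'd) \<ge> 2"
    by simp
  from body_minimax[OF this] False show ?thesis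
    by auto
qed

end
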